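(* Let $0<|q|<1$ and let $n=1,2,3,\dots$. Then $$\vartheta_3(0,q)^{2n}\,\Delta(q)^{(2n)^2}=\left\{4^{-n(n-1)}q^{-n(n-1)/2}\prod_{r=1}^{n}\bigl((2r-1)!\bigr)^{-2}\right\}\cdot\det\left(\widetilde T_{2(r+s-1)}\right)_{1\le r,s\le n},$$ where, for $i=1,2,3,\dots$, $$\widetilde T_{2i}\equiv\widetilde T_{2i}(q):=\sum_{r=1}^{\infty}\frac{(2r-1)^{2i}q^{r-1}}{1+q^{2r-1}}.$$
   Context: $\vartheta_3(0,q):=\sum_{j=-\infty}^{\infty}q^{j^2}$ and $\Delta(q):=\sum_{j=0}^{\infty}q^{j(j+1)/2}$ (the generating function of triangular numbers). *)

theory Defs
  imports "HOL-Analysis.Infinite_Sum" "Jordan_Normal_Form.Determinant"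
begin

text \<open>The null value \<open>\<vartheta>\<^sub>3(0,q)\<close>; the series is bilateral, hence an unordered sum over all
  integers (absolutely convergent for \<open>\<bar>q\<bar> < 1\<close>).\<close>

definition theta3_0 :: "complex \<Rightarrow> complex" where
  "theta3_0 q = (\<Sum>\<^sub>\<infinity>j\<in>(UNIV :: int set). q powi (j ^ 2))"

definition Delta :: "complex \<Rightarrow> complex" where
  "Delta q = (\<Sum>j. q ^ (j * (j + 1) div 2))"

text \<open>The subscript \<open>m\<close> is the exponent of the odd numbers in the numerators; only even
  \<open>m = 2 * i\<close> with \<open>i \<ge> 1\<close> is used.\<close>

definition Ttilde :: "nat \<Rightarrow> complex \<Rightarrow> complex" where
  "Ttilde m q =
     (\<Sum>\<^sub>\<infinity>r\<in>{1..}. of_nat (2 * r - 1) ^ m * q ^ (r - 1) / (1 + q ^ (2 * r - 1)))"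

text \<open>Matrices of \<open>Jordan_Normal_Form\<close> are indexed from \<open>0\<close>, so row \<open>i\<close> and column \<open>j\<close> carry
  the entry of index \<open>r = i + 1\<close>, \<open>s = j + 1\<close>.\<close>

definition Ttilde_matrix :: "nat \<Rightarrow> complex \<Rightarrow> complex mat" where
  "Ttilde_matrix n q =
     Matrix.mat n n (\<lambda>(i, j). Ttilde (2 * ((i + 1) + (j + 1) - 1)) q)"

end

theory Submission imports Defs "HOL-Complex_Analysis.Complex_Analysis" "HOL-Real_Asymp.Real_Asymp"
begin

text \<open>Up to normalisation, \<open>T\<^sub>2\<^sub>i\<close> is the Taylor coefficient of order \<open>2i\<close> of the Jacobi function
  \<open>cn\<close>, which is both a Lambert series and a quotient of theta functions. The addition theorem gives
  \<open>cn(u + v) - cn(u - v) = - 2 S(u) S(v) / (1 - k\<^sup>2 sn\<^sup>2 u sn\<^sup>2 v)\<close> with \<open>S = sn dn\<close>. Expanding the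
  geometric series, the functions \<open>S sn\<^sup>2\<^sup>m\<close> vanish to order \<open>2m + 1\<close> at \<open>0\<close>, so the Hankel matrix of the
  even derivatives is factored as \<open>LDL\<^sup>T\<close> with \<open>L\<close> triangular, and only \<open>S'(0)\<close> and \<open>sn'(0)\<close> matter.

  All theta identities are consequences of one product formula, obtained by splitting \<open>\<int>\<^sup>2\<close> according
  to the parity of \<open>m + n\<close>. The two transcendental constants (Jacobi's formula for \<open>\<vartheta>\<^sub>1'(0)\<close> and the
  scale of the Lambert series) follow from quotients that are invariant under \<open>q \<mapsto> q\<^sup>2\<close>, hence equal
  to their limit at \<open>q = 0\<close>.\<close>

section \<open>Theta series\<close>

text \<open>The theta functions are Laurent series in x = exp(2u), stripped of the factor q^(1/4),
  so everything is single-valued in q. Hence sn and dn are never normalised: with s = theta1/theta4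
  the product k^2 sn^2 sn^2 becomes q s^2 s^2, and all constants enter through derivatives at 0.

  No infinite product enters, so facts usually read off from it need another source. Nonvanishing of
  the null values is pulled back from a neighbourhood of q = 0 along q, q^2, q^4, ... . The Lambert
  series is matched with a theta quotient by comparing Laurent coefficients, which obey a
  first-order recurrence; no zeros or poles are located.

  That match leaves an unknown constant. The \<open>cn\<close> series alone does not reproduce
  itself under q -> q^2, but the \<open>dn\<close> series at q splits by parity into the
  \<open>dn\<close> and the \<open>cn\<close> series at q^2. So the constant is found for
  \<open>dn\<close> and then transferred to \<open>cn\<close>.

  In the final product theta4(0) cancels and theta2(0) occurs only together with theta3(0); since
  theta2(0) theta3(0) = 2 \<open>Delta\<close>^2, only theta3(0) and \<open>Delta\<close>
  remain.\<close>

lemma has_sum_int_split: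
  fixes f :: "int \<Rightarrow> complex"
  assumes "((\<lambda>n. f (int n)) has_sum a) UNIV" "((\<lambda>n. f (- 1 - int n)) has_sum b) UNIV"
  shows "(f has_sum (a + b)) UNIV"
proof -
  have U: "(UNIV :: int set) = range int \<union> range (\<lambda>n. - 1 - int n)"
  proof -
    have "x \<in> range int \<union> range (\<lambda>n. - 1 - int n)" for x :: int
    proof (cases "x \<ge> 0")
      case True
      then have "x = int (nat x)" by simp
      then show ?thesis by blast
    next
      case False
      then have "x = - 1 - int (nat (- 1 - x))" by simp
      then show ?thesis by blast
    qed
    then show ?thesis by blast
  qed
  have "(f has_sum a) (range int)"
    by (subst has_sum_reindex) (use assms in \<open>auto simp: o_def\<close>)
  moreover have "(f has_sum b) (range (\<lambda>n. - 1 - int n))"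
    by (subst has_sum_reindex) (use assms in \<open>auto simp: o_def inj_on_def\<close>)
  ultimately show ?thesis
    unfolding U by (rule has_sum_Un_disjoint) auto
qed

lemma has_sum_Times_complex:
  fixes f g :: "_ \<Rightarrow> complex"
  assumes "f summable_on A" "g summable_on B"
  shows "((\<lambda>(a, b). f a * g b) has_sum (infsum f A * infsum g B)) (A \<times> B)"
proof (rule has_sum_SigmaI)
  show "((\<lambda>y. case (x, y) of (a, b) \<Rightarrow> f a * g b) has_sum (f x * infsum g B)) B" for x
    using assms by (auto intro!: has_sum_cmult_right)
  show "((\<lambda>x. f x * infsum g B) has_sum (infsum f A * infsum g B)) A"
    using assms by (auto intro!: has_sum_cmult_left)
  have "(\<lambda>x. norm (f x)) summable_on A" "(\<lambda>x. norm (g x)) summable_on B"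
    using assms by (simp_all add: summable_on_iff_abs_summable_on_complex)
  then have "(\<lambda>(a,b). norm (f a * g b)) summable_on (A \<times> B)"
    by (intro summable_on_SigmaI[where g = "\<lambda>a. norm (f a) * infsum (\<lambda>b. norm (g b)) B"])
      (auto simp: norm_mult intro!: has_sum_cmult_right summable_on_cmult_left)
  then show "(\<lambda>(a,b). f a * g b) summable_on (A \<times> B)"
    by (subst summable_on_iff_abs_summable_on_complex) (simp add: case_prod_unfold)
qed

lemma summable_theta_nat:
  fixes q x :: complex
  assumes "norm q < 1"
  shows "summable (\<lambda>n. norm (q ^ (n ^ 2) * x ^ n))"
proof -
  \<comment> \<open>The n-th term is the n-th power of |q|^n |x|, which tends to 0 for every
    x.\<close>
  have "(\<lambda>n. norm q ^ n * norm x) \<longlonglongrightarrow> 0 * norm x"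
    by (intro tendsto_mult LIMSEQ_realpow_zero tendsto_const) (use assms in auto)
  then have "eventually (\<lambda>n. norm q ^ n * norm x < 1 / 2) sequentially"
    by (rule order_tendstoD) auto
  then have "eventually (\<lambda>n. norm (norm (q ^ (n ^ 2) * x ^ n)) \<le> (1 / 2) ^ n) sequentially"
  proof eventually_elim
    case (elim n)
    have "norm (norm (q ^ (n ^ 2) * x ^ n)) = (norm q ^ n * norm x) ^ n"
      by (simp add: norm_mult norm_power power_mult_distrib power2_eq_square power_mult)
    also have "\<dots> \<le> (1 / 2) ^ n"
      using elim by (intro power_mono) auto
    finally show ?case .
  qed
  then show ?thesis
    by (rule summable_comparison_test_ev) (auto intro: summable_geometric)
qed

text \<open>Jacobi's theta function as a Laurent series in the multiplicative variable. All four
  classical theta functions are its values at x, -x, q x and -q x, so one shift rule and one product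
  formula serve them all.\<close>

definition Theta :: "complex \<Rightarrow> complex \<Rightarrow> complex" where
  "Theta q x = (\<Sum>\<^sub>\<infinity>n\<in>(UNIV :: int set). q powi (n ^ 2) * x powi n)"

lemma Theta_has_sum_nat:
  fixes q x :: complex
  assumes "norm q < 1" "x \<noteq> 0"
  shows "((\<lambda>n::int. q powi (n ^ 2) * x powi n) has_sum
    ((\<Sum>n. q ^ (n ^ 2) * x ^ n) + (\<Sum>n. q ^ (Suc n ^ 2) * (1 / x) ^ Suc n))) UNIV"
proof (rule has_sum_int_split)
  have "((\<lambda>n. q ^ (n ^ 2) * x ^ n) has_sum (\<Sum>n. q ^ (n ^ 2) * x ^ n)) UNIV"
    by (intro norm_summable_imp_has_sum summable_theta_nat summable_sums[OF summable_norm_cancel] assms)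
  then show "((\<lambda>n. q powi (int n ^ 2) * x powi int n) has_sum (\<Sum>n. q ^ (n ^ 2) * x ^ n)) UNIV"
    by (rule has_sum_cong[THEN iffD1, rotated]) (simp add: power_int_of_nat flip: of_nat_power)
  have "summable (\<lambda>n. norm (q ^ (Suc n ^ 2) * (1 / x) ^ Suc n))"
    by (subst summable_Suc_iff) (rule summable_theta_nat[OF assms(1)])
  then have "((\<lambda>n. q ^ (Suc n ^ 2) * (1 / x) ^ Suc n) has_sum (\<Sum>n. q ^ (Suc n ^ 2) * (1 / x) ^ Suc n)) UNIV"
    by (intro norm_summable_imp_has_sum summable_sums[OF summable_norm_cancel])
  moreover have "q ^ (Suc n ^ 2) * (1 / x) ^ Suc n = q powi ((- 1 - int n) ^ 2) * x powi (- 1 - int n)" for n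
  proof -
    have sq: "(- 1 - int n) ^ 2 = int (Suc n ^ 2)" by (simp add: power2_eq_square algebra_simps)
    have neg: "- 1 - int n = - int (Suc n)" by simp
    show ?thesis
      unfolding sq unfolding neg power_int_minus power_int_of_nat
      by (simp only: power_one_over inverse_eq_divide)
  qed
  ultimately show "((\<lambda>n. q powi ((- 1 - int n) ^ 2) * x powi (- 1 - int n)) has_sum
      (\<Sum>n. q ^ (Suc n ^ 2) * (1 / x) ^ Suc n)) UNIV"
    by (rule has_sum_cong[THEN iffD1, rotated])
qed

lemma Theta_summable:
  fixes q x :: complex
  assumes "norm q < 1" "x \<noteq> 0"
  shows "(\<lambda>n::int. q powi (n ^ 2) * x powi n) summable_on UNIV"
  using Theta_has_sum_nat[OF assms] by (rule has_sum_imp_summable)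

lemma Theta_has_sum:
  assumes "norm q < 1" "x \<noteq> 0"
  shows "((\<lambda>n::int. q powi (n ^ 2) * x powi n) has_sum Theta q x) UNIV"
  using Theta_summable[OF assms] by (simp add: Theta_def)

lemma Theta_nat:
  assumes "norm q < 1" "x \<noteq> 0"
  shows "Theta q x = (\<Sum>n. q ^ (n ^ 2) * x ^ n) + (\<Sum>n. q ^ (Suc n ^ 2) * (1 / x) ^ Suc n)"
  using Theta_has_sum_nat[OF assms] unfolding Theta_def by (rule infsumI)

lemma Theta_inverse: "Theta q (1 / x) = Theta q x"
proof -
  have "Theta q x = (\<Sum>\<^sub>\<infinity>n\<in>(UNIV :: int set). q powi ((- n) ^ 2) * x powi (- n))"
    unfolding Theta_def
    by (rule infsum_reindex_bij_witness[where i = uminus and j = uminus]) auto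
  also have "\<dots> = Theta q (1 / x)"
    unfolding Theta_def by (intro infsum_cong) (simp add: power_int_minus power_int_divide_distrib divide_simps)
  finally show ?thesis by simp
qed

text \<open>Reindexing by n + 1 completes the square. Together with inversion this quasi-periodicity
  is used to normalise the arguments that the product formula produces.\<close>

lemma Theta_shift:
  assumes "q \<noteq> 0" "x \<noteq> 0"
  shows "q * x * Theta q (q\<^sup>2 * x) = Theta q x"
proof -
  have "Theta q x = (\<Sum>\<^sub>\<infinity>n\<in>(UNIV :: int set). q powi ((n + 1) ^ 2) * x powi (n + 1))"
    unfolding Theta_def
    by (rule infsum_reindex_bij_witness[where i = "\<lambda>n. n + 1" and j = "\<lambda>n. n - 1"]) auto
  also have "\<dots> = (\<Sum>\<^sub>\<infinity>n\<in>(UNIV :: int set). (q * x) * (q powi (n ^ 2) * (q\<^sup>2 * x) powi n))"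
  proof (intro infsum_cong)
    fix n :: int
    have "(n + 1)\<^sup>2 = n\<^sup>2 + 2 * n + 1" by (simp add: power2_eq_square algebra_simps)
    moreover have "(q\<^sup>2 * x) powi n = q powi (2 * n) * x powi n"
      using power_int_power[of q 2 n] by (simp add: power_int_mult_distrib)
    ultimately show "q powi ((n + 1) ^ 2) * x powi (n + 1) = (q * x) * (q powi (n ^ 2) * (q\<^sup>2 * x) powi n)"
      using assms by (simp add: power_int_add algebra_simps)
  qed
  also have "\<dots> = (q * x) * Theta q (q\<^sup>2 * x)"
    unfolding Theta_def by (rule infsum_cmult_right')
  finally show ?thesis by simp
qed

section \<open>The product of two theta series and the duplication identities\<close>

lemma UNIV_int_prod_parity:
  "(UNIV :: (int \<times> int) set) = range (\<lambda>(a, b). (a + b, a - b)) \<union> range (\<lambda>(a, b). (a + b + 1, a - b))"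
  "range (\<lambda>(a, b). (a + b, a - b)) \<inter> range (\<lambda>(a, b). (a + b + 1, a - b :: int)) = {}"
proof -
  have "(m, n) \<in> range (\<lambda>(a, b). (a + b, a - b)) \<union> range (\<lambda>(a, b). (a + b + 1, a - b))" for m n :: int
  proof (cases "even (m + n)")
    case True
    then have "(m, n) = (\<lambda>(a, b). (a + b, a - b)) ((m + n) div 2, (m - n) div 2)"
      by (auto elim!: evenE simp: algebra_simps) presburger+
    then show ?thesis by blast
  next
    case False
    then have "(m, n) = (\<lambda>(a, b). (a + b + 1, a - b)) ((m + n - 1) div 2, (m - n - 1) div 2)"
      by simp presburger
    then show ?thesis by blast
  qed
  then show "(UNIV :: (int \<times> int) set) = range (\<lambda>(a, b). (a + b, a - b)) \<union> range (\<lambda>(a, b). (a + b + 1, a - b))"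
    by auto
  show "range (\<lambda>(a, b). (a + b, a - b)) \<inter> range (\<lambda>(a, b). (a + b + 1, a - b :: int)) = {}"
  proof -
    have False if "a + b = c + d + 1" "a - b = c - d" for a b c d :: int
      using that by presburger
    then show ?thesis by auto
  qed
qed

text \<open>For m + n even put m = a + b, n = a - b, so m^2 + n^2 = 2a^2 + 2b^2 and the double
  series factors at nome q^2. For m + n odd put m = a + b + 1, n = a - b: the extra exponent 1 + 2a
  + 2b gives the prefactor and a factor q^2 in both arguments.\<close>

lemma Theta_mult:
  assumes q: "norm q < 1" "q \<noteq> 0" and "x \<noteq> 0" "y \<noteq> 0"
  shows "Theta q x * Theta q y = Theta (q\<^sup>2) (x * y) * Theta (q\<^sup>2) (x / y) +
           q * x * Theta (q\<^sup>2) (q\<^sup>2 * (x * y)) * Theta (q\<^sup>2) (q\<^sup>2 * (x / y))"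
proof -
  define f where "f = (\<lambda>(m :: int, n :: int). (q powi (m ^ 2) * x powi m) * (q powi (n ^ 2) * y powi n))"
  have q2: "norm (q\<^sup>2) < 1"
    using q by (simp add: norm_power power_less_one_iff)
  have pw: "(q\<^sup>2) powi n = q powi (2 * n)" for n
    using power_int_power[of q 2 n] by simp
  have 0: "(f has_sum (Theta q x * Theta q y)) UNIV"
    using has_sum_Times_complex[OF Theta_summable[OF q(1) assms(3)] Theta_summable[OF q(1) assms(4)]]
    by (simp add: Theta_def f_def)
  have "(f has_sum (Theta (q\<^sup>2) (x * y) * Theta (q\<^sup>2) (x / y))) (range (\<lambda>(a, b). (a + b, a - b)))"
  proof (subst has_sum_reindex)
    show "inj (\<lambda>(a, b). (a + b, a - b :: int))" by (auto simp: inj_on_def)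
    have "f \<circ> (\<lambda>(a, b). (a + b, a - b)) =
       (\<lambda>(a, b). ((q\<^sup>2) powi (a ^ 2) * (x * y) powi a) * ((q\<^sup>2) powi (b ^ 2) * (x / y) powi b))"
    proof (rule ext, clarify)
      fix a b :: int
      have "q powi ((a + b)\<^sup>2) * q powi ((a - b)\<^sup>2) = (q\<^sup>2) powi (a\<^sup>2) * (q\<^sup>2) powi (b\<^sup>2)"
      proof -
        have "(a + b)\<^sup>2 + (a - b)\<^sup>2 = 2 * a\<^sup>2 + 2 * b\<^sup>2"
          by (simp add: power2_eq_square algebra_simps)
        then show ?thesis
          using q power_int_add[of q "(a + b)\<^sup>2" "(a - b)\<^sup>2"] power_int_add[of q "2 * a\<^sup>2" "2 * b\<^sup>2"]
          by (metis pw)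
      qed
      moreover have "x powi (a + b) * y powi (a - b) = (x * y) powi a * (x / y) powi b"
        using assms by (simp add: power_int_add power_int_diff power_int_mult_distrib power_int_divide_distrib)
      moreover have "(f \<circ> (\<lambda>(a, b). (a + b, a - b))) (a, b) =
          (q powi ((a + b)\<^sup>2) * q powi ((a - b)\<^sup>2)) * (x powi (a + b) * y powi (a - b))"
        by (simp add: f_def mult_ac)
      ultimately show "(f \<circ> (\<lambda>(a, b). (a + b, a - b))) (a, b) =
          ((q\<^sup>2) powi (a ^ 2) * (x * y) powi a) * ((q\<^sup>2) powi (b ^ 2) * (x / y) powi b)"
        by (simp only: mult_ac)
    qed
    then show "((f \<circ> (\<lambda>(a, b). (a + b, a - b))) has_sum (Theta (q\<^sup>2) (x * y) * Theta (q\<^sup>2) (x / y))) UNIV"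
      using has_sum_Times_complex[OF Theta_summable[OF q2, of "x * y"] Theta_summable[OF q2, of "x / y"]] assms
      by (simp add: Theta_def)
  qed
  moreover have "(f has_sum (q * x * (Theta (q\<^sup>2) (q\<^sup>2 * (x * y)) * Theta (q\<^sup>2) (q\<^sup>2 * (x / y)))))
      (range (\<lambda>(a, b). (a + b + 1, a - b)))"
  proof (subst has_sum_reindex)
    show "inj (\<lambda>(a, b). (a + b + 1, a - b :: int))" by (auto simp: inj_on_def)
    have "f \<circ> (\<lambda>(a, b). (a + b + 1, a - b)) =
       (\<lambda>z. q * x * (case z of (a, b) \<Rightarrow> ((q\<^sup>2) powi (a ^ 2) * (q\<^sup>2 * (x * y)) powi a) * ((q\<^sup>2) powi (b ^ 2) * (q\<^sup>2 * (x / y)) powi b)))"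
    proof
      fix z :: "int \<times> int"
      obtain a b where z: "z = (a, b)"
        by (cases z)
      have "(a + b + 1)\<^sup>2 + (a - b)\<^sup>2 = 1 + 2 * a\<^sup>2 + 2 * b\<^sup>2 + 2 * a + 2 * b"
        by (simp add: power2_eq_square algebra_simps)
      then have "q powi ((a + b + 1)\<^sup>2) * q powi ((a - b)\<^sup>2) =
          q * (q\<^sup>2) powi (a\<^sup>2) * (q\<^sup>2) powi (b\<^sup>2) * (q\<^sup>2) powi a * (q\<^sup>2) powi b"
        using q power_int_add[of q "(a + b + 1)\<^sup>2" "(a - b)\<^sup>2"] by (simp add: pw power_int_add)
      moreover have "x powi (a + b + 1) * y powi (a - b) = x * (x * y) powi a * (x / y) powi b"
        using assms by (simp add: power_int_add power_int_diff power_int_mult_distrib power_int_divide_distrib)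
      moreover have "(q\<^sup>2 * (x * y)) powi a = (q\<^sup>2) powi a * (x * y) powi a" for a
        by (simp add: power_int_mult_distrib)
      moreover have "(q\<^sup>2 * (x / y)) powi a = (q\<^sup>2) powi a * (x / y) powi a" for a
        using power_int_mult_distrib[of "q\<^sup>2" "x / y"] by simp
      moreover have "(f \<circ> (\<lambda>(a, b). (a + b + 1, a - b))) (a, b) =
          (q powi ((a + b + 1)\<^sup>2) * q powi ((a - b)\<^sup>2)) * (x powi (a + b + 1) * y powi (a - b))"
        by (simp add: f_def mult_ac)
      ultimately show "(f \<circ> (\<lambda>(a, b). (a + b + 1, a - b))) z =
          q * x * (case z of (a, b) \<Rightarrow> ((q\<^sup>2) powi (a ^ 2) * (q\<^sup>2 * (x * y)) powi a) * ((q\<^sup>2) powi (b ^ 2) * (q\<^sup>2 * (x / y)) powi b))"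
        by (simp only: z prod.case mult_ac)
    qed
    then show "((f \<circ> (\<lambda>(a, b). (a + b + 1, a - b))) has_sum
        (q * x * (Theta (q\<^sup>2) (q\<^sup>2 * (x * y)) * Theta (q\<^sup>2) (q\<^sup>2 * (x / y))))) UNIV"
      using has_sum_cmult_right[OF has_sum_Times_complex[OF Theta_summable[OF q2, of "q\<^sup>2 * (x * y)"] Theta_summable[OF q2, of "q\<^sup>2 * (x / y)"]], of "q * x"] assms
      by (simp add: Theta_def)
  qed
  ultimately have "(f has_sum (Theta (q\<^sup>2) (x * y) * Theta (q\<^sup>2) (x / y) +
           q * x * (Theta (q\<^sup>2) (q\<^sup>2 * (x * y)) * Theta (q\<^sup>2) (q\<^sup>2 * (x / y))))) UNIV"
    using UNIV_int_prod_parity has_sum_Un_disjoint[of f] by (metis (no_types, lifting))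
  then show ?thesis
    using has_sum_unique[OF 0] by (simp add: mult.assoc)
qed

text \<open>Shift and inversion at -1/q make this value its own negative. It is the zero of theta1
  at 0, and it is what removes the odd half of the product formula in several identities
  below.\<close>

lemma Theta_neg_self_eq_0:
  assumes "q \<noteq> 0"
  shows "Theta q (- q) = 0"
  using Theta_shift[of q "- 1 / q"] Theta_inverse[of q "- q"] assms
  by (simp add: power2_eq_square field_simps)

text \<open>Both halves of the product formula coincide, hence the 2. This is where the triangular
  numbers come in: \<open>Theta (q\<^sup>2) q\<close> is \<open>Delta q\<close>.\<close>

lemma Theta_1_mult_Theta_self:
  assumes "norm q < 1" "q \<noteq> 0"
  shows "Theta q 1 * Theta q q = 2 * (Theta (q\<^sup>2) q)\<^sup>2"
proof -
  have "Theta (q\<^sup>2) (q\<^sup>2 * q) * q = Theta (q\<^sup>2) q"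
    using Theta_shift[of "q\<^sup>2" "1 / q"] Theta_inverse[of "q\<^sup>2" q] assms
    by (simp add: power2_eq_square field_simps)
  moreover have "q\<^sup>2 * (1 / q) = q"
    using assms by (simp add: power2_eq_square)
  ultimately show ?thesis
    using Theta_mult[of q 1 q] Theta_inverse[of "q\<^sup>2" q] assms
    by (simp add: power2_eq_square algebra_simps)
qed

lemma Theta_self_power2:
  assumes "norm q < 1" "q \<noteq> 0"
  shows "(Theta q q)\<^sup>2 = 2 * Theta (q\<^sup>2) (q\<^sup>2) * Theta (q\<^sup>2) 1"
proof -
  have "q\<^sup>2 * Theta (q\<^sup>2) (q\<^sup>2 * (q * q)) = Theta (q\<^sup>2) 1"
    using Theta_shift[of "q\<^sup>2" 1] assms by (simp add: power2_eq_square)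
  then show ?thesis
    using Theta_mult[of q q q] assms by (simp add: power2_eq_square algebra_simps)
qed

text \<open>With the two squares below this is a step of the arithmetic-geometric mean: the null
  values at q and q^2 are related as an iterate and its successor.\<close>

lemma Theta_1_mult_Theta_minus_1:
  assumes "norm q < 1" "q \<noteq> 0"
  shows "Theta q 1 * Theta q (- 1) = (Theta (q\<^sup>2) (- 1))\<^sup>2"
  using Theta_mult[of q 1 "- 1"] Theta_neg_self_eq_0[of "q\<^sup>2"] assms
  by (simp add: power2_eq_square)

lemma Theta_1_power2:
  assumes "norm q < 1" "q \<noteq> 0"
  shows "(Theta q 1)\<^sup>2 = (Theta (q\<^sup>2) 1)\<^sup>2 + q * (Theta (q\<^sup>2) (q\<^sup>2))\<^sup>2"
  using Theta_mult[of q 1 1] assms by (simp add: power2_eq_square mult.assoc)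

lemma Theta_minus_1_power2:
  assumes "norm q < 1" "q \<noteq> 0"
  shows "(Theta q (- 1))\<^sup>2 = (Theta (q\<^sup>2) 1)\<^sup>2 - q * (Theta (q\<^sup>2) (q\<^sup>2))\<^sup>2"
  using Theta_mult[of q "- 1" "- 1"] assms by (simp add: power2_eq_square mult.assoc)

section \<open>The Landen and addition identities\<close>

lemma Theta_landen:
  assumes "norm q < 1" "q \<noteq> 0" "x \<noteq> 0"
  shows "Theta q (q * x) * Theta q (- q * x) = Theta (q\<^sup>2) (- (q\<^sup>2) * x\<^sup>2) * Theta (q\<^sup>2) (- 1)"
  using Theta_mult[of q "q * x" "- q * x"] Theta_neg_self_eq_0[of "q\<^sup>2"] assms
  by (simp add: power2_eq_square mult_ac)

text \<open>Substituting x y and x / y separates the variables: the right side is a sum of two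
  products of a function of x and a function of y. This reduces addition identities to algebra in
  two functions \<open>a\<close> and \<open>b\<close>.\<close>

lemma Theta_mult_shifted:
  assumes "norm q < 1" "q \<noteq> 0" "x \<noteq> 0" "y \<noteq> 0"
  shows "Theta q (x * y) * Theta q (x / y) = Theta (q\<^sup>2) (x\<^sup>2) * Theta (q\<^sup>2) (y\<^sup>2) +
      q * x * y * Theta (q\<^sup>2) (q\<^sup>2 * x\<^sup>2) * Theta (q\<^sup>2) (q\<^sup>2 * y\<^sup>2)"
  using Theta_mult[of q "x * y" "x / y"] assms by (simp add: power2_eq_square field_simps)

text \<open>With X = x \<open>b x\<close> and Y = y \<open>b y\<close> the claim is the polynomial
  identity (\<open>a x\<close> \<open>a 1\<close> - q X \<open>b 1\<close>)(\<open>a y\<close>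
  \<open>a 1\<close> - q Y \<open>b 1\<close>) - q (X \<open>a 1\<close> - \<open>a x\<close>
  \<open>b 1\<close>)(Y \<open>a 1\<close> - \<open>a y\<close> \<open>b 1\<close>) =
  (\<open>a 1\<close>^2 - q \<open>b 1\<close>^2)(\<open>a x\<close> \<open>a y\<close> - q X
  Y).\<close>

lemma Theta_addition_denominator:
  assumes q: "norm q < 1" "q \<noteq> 0" and "x \<noteq> 0" "y \<noteq> 0"
  shows "Theta q (- (x * y)) * Theta q (- (x / y)) * (Theta q (- 1))\<^sup>2 =
    (Theta q (- x))\<^sup>2 * (Theta q (- y))\<^sup>2 - q * (x * y) * (Theta q (- q * x))\<^sup>2 * (Theta q (- q * y))\<^sup>2"
proof -
  define a where "a = (\<lambda>x. Theta (q\<^sup>2) (x\<^sup>2))"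
  define b where "b = (\<lambda>x. Theta (q\<^sup>2) (q\<^sup>2 * x\<^sup>2))"
  have lhs: "Theta q (- (x * y)) * Theta q (- (x / y)) = a x * a y - q * x * y * b x * b y"
    using Theta_mult_shifted[of q "- x" y] assms by (simp add: a_def b_def)
  have sq: "(Theta q (- x))\<^sup>2 = a x * a 1 - q * x * b x * b 1" if "x \<noteq> 0" for x
    using Theta_mult_shifted[of q "- x" 1] assms that by (simp add: a_def b_def power2_eq_square)
  have sq': "x * (Theta q (- q * x))\<^sup>2 = x * b x * a 1 - a x * b 1" if "x \<noteq> 0" for x
  proof -
    \<comment> \<open>\<open>b\<close> at q x is \<open>a\<close> at x up to a factor, because q^2
      (q x)^2 = q^4 x^2 is one quasi-period of \<open>Theta (q\<^sup>2)\<close> away from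
      x^2.\<close>
    have h: "q\<^sup>2 * x\<^sup>2 * Theta (q\<^sup>2) (q\<^sup>2 * (q * x)\<^sup>2) = a x"
      using Theta_shift[of "q\<^sup>2" "x\<^sup>2"] Theta_shift[of "q\<^sup>2" "q\<^sup>2 * x\<^sup>2"] q that
      by (simp add: a_def power_mult_distrib mult_ac)
    have "(Theta q (- q * x))\<^sup>2 =
        b x * a 1 - q * (q * x) * Theta (q\<^sup>2) (q\<^sup>2 * (q * x)\<^sup>2) * b 1"
      using Theta_mult_shifted[of q "- (q * x)" 1] q that
      by (simp add: a_def b_def power2_eq_square mult_ac)
    then have "x * (Theta q (- q * x))\<^sup>2 =
        x * (b x * a 1 - q * (q * x) * Theta (q\<^sup>2) (q\<^sup>2 * (q * x)\<^sup>2) * b 1)"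
      by (simp only:)
    also have "\<dots> = x * b x * a 1 - (q\<^sup>2 * x\<^sup>2 * Theta (q\<^sup>2) (q\<^sup>2 * (q * x)\<^sup>2)) * b 1"
      by (simp add: algebra_simps power2_eq_square)
    finally show ?thesis
      unfolding h .
  qed
  have nul: "(Theta q (- 1))\<^sup>2 = (a 1)\<^sup>2 - q * (b 1)\<^sup>2"
    using sq[of 1] by (simp add: power2_eq_square)
  have prod: "q * (x * y) * (Theta q (- q * x))\<^sup>2 * (Theta q (- q * y))\<^sup>2 =
      q * (x * b x * a 1 - a x * b 1) * (y * b y * a 1 - a y * b 1)"
    unfolding sq'[OF assms(3), symmetric] sq'[OF assms(4), symmetric] by (simp add: mult_ac)
  show ?thesis
    unfolding lhs sq[OF assms(3)] sq[OF assms(4)] prod nul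
    by (simp add: algebra_simps power2_eq_square)
qed

lemma Theta_addition_numerator:
  assumes q: "norm q < 1" "q \<noteq> 0" and "x \<noteq> 0" "y \<noteq> 0"
  shows "Theta q (q * (x * y)) * Theta q (- (x / y)) * Theta q q * Theta q (- 1) =
    Theta q (q * x) * Theta q (- x) * Theta q (q * y) * Theta q (- y) +
    Theta q (- q * x) * Theta q x * Theta q (- q * y) * Theta q y"
proof -
  define a where "a = (\<lambda>x. Theta (q\<^sup>2) (- q * x\<^sup>2))"
  define b where "b = (\<lambda>x. Theta (q\<^sup>2) (- (q ^ 3) * x\<^sup>2))"
  \<comment> \<open>This relation between the null values makes the products at y = 1 factor as
    \<open>a 1\<close> (\<open>a x\<close> - q x \<open>b x\<close>), with the other sign at -x. In
    the sum of the two products over x and y the mixed terms then cancel.\<close>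
  have b1: "q * b 1 = - a 1"
    using Theta_shift[of "q\<^sup>2" "- 1 / q"] Theta_inverse[of "q\<^sup>2" "- q"] q
    by (simp add: a_def b_def power2_eq_square power3_eq_cube field_simps) (metis minus_minus)
  have 1: "Theta q (q * (x * y)) * Theta q (- (x / y)) = a x * a y + q\<^sup>2 * x * y * b x * b y"
    if "x \<noteq> 0" "y \<noteq> 0" for x y
  proof -
    have "q * (x * y) * (- (x / y)) = - q * x\<^sup>2" "q * (x * y) / (- (x / y)) = - q * y\<^sup>2"
      "q\<^sup>2 * (- q * x\<^sup>2) = - (q ^ 3) * x\<^sup>2" if "x \<noteq> 0" "y \<noteq> 0" for x y :: complex
      using that q by (auto simp: power2_eq_square power3_eq_cube field_simps)
    from this(1,2)[OF that] this(3)[OF that] this(3)[OF that(2,1)] show ?thesis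
      using Theta_mult[of q "q * (x * y)" "- (x / y)"] q that
      by (simp only: a_def b_def) (simp add: power2_eq_square mult_ac)
  qed
  have 2: "Theta q (q * x) * Theta q (- x) = a 1 * (a x - q * x * b x)" if "x \<noteq> 0" for x
  proof -
    have "Theta q (q * x) * Theta q (- x) = a x * a 1 + q * x * b x * (q * b 1)"
      using 1[of x 1] that by (simp add: power2_eq_square mult_ac)
    then show ?thesis
      unfolding b1 by (simp add: algebra_simps)
  qed
  have 3: "Theta q (- q * x) * Theta q x = a 1 * (a x + q * x * b x)" if "x \<noteq> 0" for x
    using 2[of "- x"] that by (simp add: a_def b_def)
  have "Theta q q * Theta q (- 1) = 2 * (a 1)\<^sup>2"
    using 2[of 1] b1 by (simp add: power2_eq_square)
  then have "(Theta q (q * (x * y)) * Theta q (- (x / y))) * (Theta q q * Theta q (- 1)) =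
      (Theta q (q * x) * Theta q (- x)) * (Theta q (q * y) * Theta q (- y)) +
      (Theta q (- q * x) * Theta q x) * (Theta q (- q * y) * Theta q y)"
    unfolding 1[OF assms(3,4)] 2[OF assms(3)] 2[OF assms(4)] 3[OF assms(3)] 3[OF assms(4)]
    by (simp add: algebra_simps power2_eq_square)
  then show ?thesis
    by (simp only: mult.assoc)
qed

section \<open>Lambert series as theta quotients\<close>

text \<open>Up to constants the Fourier series of \<open>dn\<close> for \<alpha> = 1, and of
  \<open>cn\<close> (after a factor exp u at x = exp(2u)) for \<alpha> = q. A free \<alpha> lets one
  argument treat both.\<close>

definition Lambert :: "complex \<Rightarrow> complex \<Rightarrow> complex \<Rightarrow> complex" where
  "Lambert q \<alpha> x = (\<Sum>\<^sub>\<infinity>m\<in>(UNIV :: int set). q powi m / (1 + \<alpha> * q powi (2 * m)) * x powi m)"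

text \<open>On the annulus |q| < |x| < 1/|q| both halves are dominated by geometric series. For m =
  -k multiplying through by q^(2k) leaves the coefficient q^k / (q^(2k) + \<alpha>), whose
  denominator tends to \<alpha>, which is nonzero.\<close>

lemma Lambert_has_sum_nat:
  fixes q \<alpha> x :: complex
  assumes q: "q \<noteq> 0" "norm q < 1" and \<alpha>: "\<alpha> \<noteq> 0" and x: "norm q < norm x" "norm (q * x) < 1"
  shows "((\<lambda>m. q powi m / (1 + \<alpha> * q powi (2 * m)) * x powi m) has_sum
     ((\<Sum>k. q ^ k / (1 + \<alpha> * q ^ (2 * k)) * x ^ k) +
      (\<Sum>k. q ^ Suc k / (q ^ (2 * Suc k) + \<alpha>) * (1 / x) ^ Suc k))) UNIV"
proof (rule has_sum_int_split)
  have lim: "(\<lambda>k. q ^ (2 * k)) \<longlonglongrightarrow> 0"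
    using q LIMSEQ_power_zero[of "q\<^sup>2"] by (simp add: power_mult norm_power power_less_one_iff)
  have x0: "x \<noteq> 0" using x q by auto
  have "(\<lambda>k. norm (1 + \<alpha> * q ^ (2 * k))) \<longlonglongrightarrow> norm (1 + \<alpha> * 0)"
    by (intro tendsto_intros lim)
  then have "eventually (\<lambda>k. norm (1 + \<alpha> * q ^ (2 * k)) > 1 / 2) sequentially"
    by (rule order_tendstoD) auto
  then have "eventually (\<lambda>k. norm (norm (q ^ k / (1 + \<alpha> * q ^ (2 * k)) * x ^ k)) \<le> 2 * norm (q * x) ^ k) sequentially"
  proof eventually_elim
    case (elim k)
    have "norm (q * x) ^ k / norm (1 + \<alpha> * q ^ (2 * k)) \<le> norm (q * x) ^ k / (1 / 2)"
      using elim by (intro divide_left_mono) auto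
    then show ?case
      by (simp add: norm_mult norm_divide norm_power power_mult_distrib mult_ac)
  qed
  then have "summable (\<lambda>k. norm (q ^ k / (1 + \<alpha> * q ^ (2 * k)) * x ^ k))"
    by (rule summable_comparison_test_ev) (use x in \<open>auto intro!: summable_mult summable_geometric\<close>)
  then have "((\<lambda>k. q ^ k / (1 + \<alpha> * q ^ (2 * k)) * x ^ k) has_sum
      (\<Sum>k. q ^ k / (1 + \<alpha> * q ^ (2 * k)) * x ^ k)) UNIV"
    by (intro norm_summable_imp_has_sum summable_sums[OF summable_norm_cancel])
  moreover have "q powi (2 * int k) = q ^ (2 * k)" for k
    using power_int_of_nat[of q "2 * k"] by simp
  ultimately show "((\<lambda>k. q powi int k / (1 + \<alpha> * q powi (2 * int k)) * x powi int k) has_sum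
      (\<Sum>k. q ^ k / (1 + \<alpha> * q ^ (2 * k)) * x ^ k)) UNIV"
    by (simp only: power_int_of_nat)
  have "(\<lambda>k. norm (q ^ (2 * k) + \<alpha>)) \<longlonglongrightarrow> norm (0 + \<alpha>)"
    by (intro tendsto_intros lim)
  then have "eventually (\<lambda>k. norm (q ^ (2 * k) + \<alpha>) > norm \<alpha> / 2) sequentially"
    by (rule order_tendstoD) (use \<alpha> in auto)
  then have "eventually (\<lambda>k. norm (norm (q ^ k / (q ^ (2 * k) + \<alpha>) * (1 / x) ^ k)) \<le> 2 / norm \<alpha> * norm (q / x) ^ k) sequentially"
  proof eventually_elim
    case (elim k)
    have "norm (q / x) ^ k / norm (q ^ (2 * k) + \<alpha>) \<le> norm (q / x) ^ k / (norm \<alpha> / 2)"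
      using elim \<alpha> by (intro divide_left_mono) (auto intro!: mult_pos_pos)
    then show ?case
      by (simp add: norm_mult norm_divide norm_power power_divide mult_ac)
  qed
  moreover have "summable (\<lambda>k. 2 / norm \<alpha> * norm (q / x) ^ k)"
    by (intro summable_mult summable_geometric) (use x x0 in \<open>auto simp: norm_divide divide_simps\<close>)
  ultimately have "summable (\<lambda>k. norm (q ^ k / (q ^ (2 * k) + \<alpha>) * (1 / x) ^ k))"
    by (rule summable_comparison_test_ev)
  then have "summable (\<lambda>k. norm (q ^ Suc k / (q ^ (2 * Suc k) + \<alpha>) * (1 / x) ^ Suc k))"
    by (subst summable_Suc_iff)
  then have "((\<lambda>k. q ^ Suc k / (q ^ (2 * Suc k) + \<alpha>) * (1 / x) ^ Suc k) has_sum
      (\<Sum>k. q ^ Suc k / (q ^ (2 * Suc k) + \<alpha>) * (1 / x) ^ Suc k)) UNIV"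
    by (intro norm_summable_imp_has_sum summable_sums[OF summable_norm_cancel])
  moreover have "q ^ Suc k / (q ^ (2 * Suc k) + \<alpha>) * (1 / x) ^ Suc k =
      q powi (- 1 - int k) / (1 + \<alpha> * q powi (2 * (- 1 - int k))) * x powi (- 1 - int k)" for k
  proof -
    have neg: "- 1 - int k = - int (Suc k)" "2 * - int (Suc k) = - int (2 * Suc k)" by simp_all
    have "a / (a * a + \<alpha>) = inverse a / (1 + \<alpha> * inverse (a * a))" if "a \<noteq> 0" for a :: complex
    proof -
      have "1 + \<alpha> * inverse (a * a) = (a * a + \<alpha>) / (a * a)"
        using that by (simp add: field_simps)
      then show ?thesis
        using that by simp
    qed
    from this[of "q ^ Suc k"] q show ?thesis
      unfolding neg power_int_minus power_int_of_nat
      by (simp only: power_one_over inverse_eq_divide mult_2 power_add) simp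
  qed
  ultimately show "((\<lambda>k. q powi (- 1 - int k) / (1 + \<alpha> * q powi (2 * (- 1 - int k))) * x powi (- 1 - int k)) has_sum
      (\<Sum>k. q ^ Suc k / (q ^ (2 * Suc k) + \<alpha>) * (1 / x) ^ Suc k)) UNIV"
    by (rule has_sum_cong[THEN iffD1, rotated])
qed

lemma Lambert_summable:
  fixes q \<alpha> x :: complex
  assumes "q \<noteq> 0" "norm q < 1" "\<alpha> \<noteq> 0" "norm q < norm x" "norm (q * x) < 1"
  shows "(\<lambda>m. q powi m / (1 + \<alpha> * q powi (2 * m)) * x powi m) summable_on UNIV"
  using Lambert_has_sum_nat[OF assms] by (rule has_sum_imp_summable)

lemma Lambert_nat:
  assumes "q \<noteq> 0" "norm q < 1" "\<alpha> \<noteq> 0" "norm q < norm x" "norm (q * x) < 1"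
  shows "Lambert q \<alpha> x = (\<Sum>k. q ^ k / (1 + \<alpha> * q ^ (2 * k)) * x ^ k) +
      (\<Sum>k. q ^ Suc k / (q ^ (2 * Suc k) + \<alpha>) * (1 / x) ^ Suc k)"
  using Lambert_has_sum_nat[OF assms] unfolding Lambert_def by (rule infsumI)

lemma int_recurrence_unique:
  fixes c d :: "int \<Rightarrow> complex"
  assumes "\<And>j. c j = r j * c (j - 1)" "\<And>j. d j = r j * d (j - 1)" "\<And>j. r j \<noteq> 0" "c 0 = d 0"
  shows "c j = d j"
proof (induction j rule: int_induct[where k = 0])
  case base
  then show ?case by (rule assms)
next
  case (step1 i)
  then show ?case using assms(1,2)[of "i + 1"] by simp
next
  case (step2 i)
  then show ?case using assms(1,2,3)[of i] by auto
qed

text \<open>Let c_j be the Laurent coefficients of the left side. In c_j - \<alpha> q^(2j-1) c_(j-1)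
  the Lambert denominators cancel and what is left is q^j \<open>Theta q (- 1 / q)\<close> = 0. The
  coefficients \<alpha>^j q^(j^2) of \<open>Theta q (\<alpha> * x)\<close> obey the same recurrence,
  so the two sequences are proportional.\<close>

lemma Lambert_Theta_exists:
  fixes q \<alpha> :: complex
  assumes q: "q \<noteq> 0" "norm q < 1" and \<alpha>: "\<alpha> \<noteq> 0" "\<And>m. 1 + \<alpha> * q powi (2 * m) \<noteq> 0"
  shows "\<exists>c. \<forall>x. norm q < norm x \<longrightarrow> norm (q * x) < 1 \<longrightarrow>
    Lambert q \<alpha> x * Theta q (- x) = c * Theta q (\<alpha> * x)"
proof -
  define a where "a m = q powi m / (1 + \<alpha> * q powi (2 * m))" for m
  define b where "b n = q powi (n ^ 2) * (- 1) powi n" for n :: int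
  define c where "c j = (\<Sum>\<^sub>\<infinity>m\<in>(UNIV :: int set). a m * b (j - m))" for j
  have double: "((\<lambda>(j, m). x powi j * (a m * b (j - m))) has_sum (Lambert q \<alpha> x * Theta q (- x))) (UNIV \<times> UNIV)"
    if x: "norm q < norm x" "norm (q * x) < 1" for x
  proof -
    have x0: "x \<noteq> 0" using x q by auto
    have "((\<lambda>(m, n). (a m * x powi m) * (q powi (n ^ 2) * (- x) powi n)) has_sum
        (Lambert q \<alpha> x * Theta q (- x))) (UNIV \<times> UNIV)"
      unfolding Lambert_def Theta_def a_def
      by (intro has_sum_Times_complex Lambert_summable Theta_summable) (use q \<alpha> x x0 in auto)
    also have "?this \<longleftrightarrow> ((\<lambda>(j, m). x powi j * (a m * b (j - m))) has_sum
        (Lambert q \<alpha> x * Theta q (- x))) (UNIV \<times> UNIV)"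
    proof (rule has_sum_reindex_bij_witness[where i = "\<lambda>(j, m). (m, j - m)" and j = "\<lambda>(m, n). (m + n, m)"])
      show "(case (case z of (m, n) \<Rightarrow> (m + n, m)) of (j, m) \<Rightarrow> x powi j * (a m * b (j - m))) =
          (case z of (m, n) \<Rightarrow> (a m * x powi m) * (q powi (n ^ 2) * (- x) powi n))" for z
      proof (cases z)
        case (Pair m n)
        have "(- x) powi n = (- 1) powi n * x powi n"
          using power_int_mult_distrib[of "- 1" x n] by simp
        then show ?thesis
          using x0 by (simp add: Pair b_def power_int_add)
      qed
    qed auto
    finally show ?thesis .
  qed
  \<comment> \<open>Each coefficient is one row of the double series at x = 1, a point of the
    annulus.\<close>
  have c_summable: "(\<lambda>m. a m * b (j - m)) summable_on UNIV" for j
    using summable_on_SigmaD1[of "\<lambda>j m. 1 powi j * (a m * b (j - m))" UNIV "\<lambda>_. UNIV" j]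
      has_sum_imp_summable[OF double[of 1]] q by simp
  have rec: "c j = (\<alpha> * q powi (2 * j - 1)) * c (j - 1)" for j
  proof -
    \<comment> \<open>The factor of the recurrence is chosen so that lowering j by 1 turns into
      -q^(2m), independent of j: exactly the term that completes the denominator of
      \<open>a m\<close>.\<close>
    have b_pred: "q powi (2 * j - 1) * b (j - 1 - m) = - (q powi (2 * m) * b (j - m))" for m
    proof -
      have "q powi (2 * j - 1) * q powi ((j - 1 - m)\<^sup>2) = q powi (2 * m) * q powi ((j - m)\<^sup>2)"
      proof -
        have "2 * j - 1 + (j - 1 - m)\<^sup>2 = 2 * m + (j - m)\<^sup>2"
          by (simp add: power2_eq_square algebra_simps)
        then show ?thesis
          using q by (simp flip: power_int_add)
      qed
      moreover have "(- 1 :: complex) powi (j - 1 - m) = - ((- 1) powi (j - m))"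
        using power_int_diff[of "- 1 :: complex" "j - m" 1] by (simp add: algebra_simps)
      ultimately show ?thesis
        by (simp add: b_def)
    qed
    have "c j - (\<alpha> * q powi (2 * j - 1)) * c (j - 1) =
        (\<Sum>\<^sub>\<infinity>m\<in>UNIV. a m * b (j - m)) + (\<Sum>\<^sub>\<infinity>m\<in>UNIV. - (\<alpha> * q powi (2 * j - 1)) * (a m * b (j - 1 - m)))"
      by (simp add: c_def infsum_cmult_right' infsum_uminus)
    also have "\<dots> = (\<Sum>\<^sub>\<infinity>m\<in>UNIV. a m * b (j - m) + - (\<alpha> * q powi (2 * j - 1)) * (a m * b (j - 1 - m)))"
      by (rule infsum_add[symmetric]) (intro c_summable summable_on_cmult_right)+
    also have "\<dots> = (\<Sum>\<^sub>\<infinity>m\<in>UNIV. q powi m * b (j - m))"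
    proof (rule infsum_cong)
      fix m
      have "- (\<alpha> * q powi (2 * j - 1)) * (a m * b (j - 1 - m)) =
          - \<alpha> * a m * (q powi (2 * j - 1) * b (j - 1 - m))"
        by (simp add: mult_ac)
      also have "\<dots> = a m * (\<alpha> * q powi (2 * m)) * b (j - m)"
        unfolding b_pred by (simp add: mult_ac)
      finally have "a m * b (j - m) + - (\<alpha> * q powi (2 * j - 1)) * (a m * b (j - 1 - m)) =
          (a m * (1 + \<alpha> * q powi (2 * m))) * b (j - m)"
        by (simp add: algebra_simps)
      also have "a m * (1 + \<alpha> * q powi (2 * m)) = q powi m"
        using \<alpha>(2)[of m] by (simp add: a_def)
      finally show "a m * b (j - m) + - (\<alpha> * q powi (2 * j - 1)) * (a m * b (j - 1 - m)) = q powi m * b (j - m)" .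
    qed
    also have "\<dots> = (\<Sum>\<^sub>\<infinity>n\<in>UNIV. q powi j * (q powi (n ^ 2) * (- 1 / q) powi n))"
    proof (rule infsum_reindex_bij_witness[where i = "\<lambda>n. j - n" and j = "\<lambda>m. j - m"])
      fix m
      have "(- 1 / q) powi (j - m) = (- 1) powi (j - m) / q powi (j - m)"
        by (rule power_int_divide_distrib)
      then show "q powi j * (q powi ((j - m) ^ 2) * (- 1 / q) powi (j - m)) = q powi m * b (j - m)"
        using q by (simp add: b_def power_int_diff)
    qed auto
    also have "\<dots> = q powi j * Theta q (- 1 / q)"
      unfolding Theta_def by (rule infsum_cmult_right')
    also have "Theta q (- 1 / q) = 0"
      using Theta_inverse[of q "- q"] Theta_neg_self_eq_0[OF q(1)] by simp
    finally show ?thesis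
      by simp
  qed
  have c: "c j = (\<alpha> powi j * q powi (j ^ 2)) * c 0" for j
  proof (rule int_recurrence_unique[of c "\<lambda>j. \<alpha> * q powi (2 * j - 1)"])
    fix j :: int
    have "2 * j - 1 + (j - 1)\<^sup>2 = j\<^sup>2"
      by (simp add: power2_eq_square algebra_simps)
    then have "q powi (j ^ 2) = q powi (2 * j - 1) * q powi ((j - 1)\<^sup>2)"
      using q by (simp flip: power_int_add)
    moreover have "\<alpha> powi j = \<alpha> * \<alpha> powi (j - 1)"
      using \<alpha> by (simp add: power_int_diff)
    ultimately show "\<alpha> powi j * q powi (j ^ 2) * c 0 =
        \<alpha> * q powi (2 * j - 1) * (\<alpha> powi (j - 1) * q powi ((j - 1)\<^sup>2) * c 0)"
      by (simp add: mult_ac)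
  next
    show "c j = \<alpha> * q powi (2 * j - 1) * c (j - 1)" for j
      by (rule rec)
  qed (use q \<alpha> in auto)
  have "Lambert q \<alpha> x * Theta q (- x) = c 0 * Theta q (\<alpha> * x)"
    if x: "norm q < norm x" "norm (q * x) < 1" for x
  proof -
    have "((\<lambda>j. x powi j * c j) has_sum (Lambert q \<alpha> x * Theta q (- x))) UNIV"
    proof (rule has_sum_SigmaD[OF double[OF x]])
      show "((\<lambda>m. case (j, m) of (j, m) \<Rightarrow> x powi j * (a m * b (j - m))) has_sum (x powi j * c j)) UNIV" for j
        unfolding c_def using c_summable[of j] by (auto intro!: has_sum_cmult_right)
    qed
    also have "(\<lambda>j. x powi j * c j) = (\<lambda>j. c 0 * (q powi (j ^ 2) * (\<alpha> * x) powi j))"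
    proof
      fix j
      show "x powi j * c j = c 0 * (q powi (j ^ 2) * (\<alpha> * x) powi j)"
        using c[of j] by (simp add: power_int_mult_distrib)
    qed
    finally have "((\<lambda>j. c 0 * (q powi (j ^ 2) * (\<alpha> * x) powi j)) has_sum (Lambert q \<alpha> x * Theta q (- x))) UNIV" .
    moreover have "((\<lambda>j. c 0 * (q powi (j ^ 2) * (\<alpha> * x) powi j)) has_sum (c 0 * Theta q (\<alpha> * x))) UNIV"
      by (intro has_sum_cmult_right Theta_has_sum) (use q \<alpha> x in auto)
    ultimately show ?thesis
      by (rule has_sum_unique)
  qed
  then show ?thesis by blast
qed

section \<open>Limits at zero and invariance under squaring the nome\<close>

lemma norm_suminf_geometric_le:
  fixes f :: "nat \<Rightarrow> complex"
  assumes "\<And>k. norm (f k) \<le> M * (1 / 2) ^ k"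
  shows "summable f" "norm (suminf f) \<le> 2 * M"
proof -
  have s: "summable (\<lambda>k. M * (1 / 2) ^ k)"
    by (intro summable_mult summable_geometric) auto
  have sf: "summable (\<lambda>k. norm (f k))"
    using assms by (intro summable_comparison_test[OF _ s]) auto
  then show "summable f"
    by (rule summable_norm_cancel)
  have "norm (suminf f) \<le> (\<Sum>k. norm (f k))"
    by (rule summable_norm[OF sf])
  also have "\<dots> \<le> (\<Sum>k. M * (1 / 2) ^ k)"
    by (rule suminf_le[OF assms sf s])
  also have "\<dots> = 2 * M"
    by (subst suminf_mult) (auto simp: suminf_geometric)
  finally show "norm (suminf f) \<le> 2 * M" .
qed

lemma tendsto_at_0_linear_bound:
  fixes f :: "complex \<Rightarrow> complex"
  assumes "\<epsilon> > 0" "\<And>q. q \<noteq> 0 \<Longrightarrow> norm q \<le> \<epsilon> \<Longrightarrow> norm (f q - L) \<le> C * norm q"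
  shows "(f \<longlongrightarrow> L) (at 0)"
proof -
  have "((\<lambda>q. f q - L) \<longlongrightarrow> 0) (at 0)"
  proof (rule Lim_null_comparison)
    show "eventually (\<lambda>q. norm (f q - L) \<le> C * norm q) (at 0)"
      unfolding eventually_at using assms by (intro exI[of _ \<epsilon>]) auto
    show "((\<lambda>q :: complex. C * norm q) \<longlongrightarrow> 0) (at 0)"
      by (rule tendsto_eq_intros refl | simp)+
  qed
  then show ?thesis
    by (simp add: LIM_zero_iff)
qed

lemma filterlim_iterated_square_at_0:
  fixes q :: complex
  assumes "q \<noteq> 0" "norm q < 1"
  shows "filterlim (\<lambda>n. q ^ (2 ^ n)) (at 0) sequentially"
proof (rule filterlim_atI)
  have "filterlim (\<lambda>n :: nat. 2 ^ n :: nat) at_top sequentially"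
    by (rule filterlim_subseq) (simp add: strict_mono_def)
  then show "(\<lambda>n. q ^ (2 ^ n)) \<longlonglongrightarrow> 0"
    by (rule filterlim_compose[OF LIMSEQ_power_zero[OF assms(2)]])
qed (use assms in auto)

lemma square_invariant_eq_limit:
  fixes R :: "complex \<Rightarrow> complex"
  assumes inv: "\<And>q. q \<noteq> 0 \<Longrightarrow> norm q < 1 \<Longrightarrow> R q = R (q\<^sup>2)"
    and lim: "(R \<longlongrightarrow> L) (at 0)" and q: "q \<noteq> 0" "norm q < 1"
  shows "R q = L"
proof -
  have "R (q ^ (2 ^ n)) = R q" for n
  proof (induction n)
    case (Suc n)
    have "norm (q ^ (2 ^ n)) < 1"
      using q by (simp add: norm_power power_less_one_iff)
    then have "R (q ^ (2 ^ n)) = R ((q ^ (2 ^ n))\<^sup>2)"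
      using q by (intro inv) auto
    then show ?case
      using Suc by (simp add: power_mult[symmetric] mult.commute)
  qed simp
  then have "(\<lambda>_ :: nat. R q) \<longlonglongrightarrow> L"
    using filterlim_compose[OF lim filterlim_iterated_square_at_0[OF q]] by simp
  then show ?thesis
    by (simp add: LIMSEQ_const_iff)
qed

text \<open>This replaces a product formula in proofs of nonvanishing: the property holds near 0 and
  is pulled back from q^(2^n) to q, one squaring at a time.\<close>

lemma square_descent:
  fixes P :: "complex \<Rightarrow> bool"
  assumes desc: "\<And>q. q \<noteq> 0 \<Longrightarrow> norm q < 1 \<Longrightarrow> P (q\<^sup>2) \<Longrightarrow> P q"
    and ev: "eventually P (at 0)" and q: "q \<noteq> 0" "norm q < 1"
  shows "P q"
proof -
  have *: "P (q ^ (2 ^ n)) \<Longrightarrow> P q" for n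
  proof (induction n)
    case (Suc n)
    have 1: "norm (q ^ (2 ^ n)) < 1"
      using q by (simp add: norm_power power_less_one_iff)
    have 2: "P ((q ^ (2 ^ n))\<^sup>2)"
      using Suc.prems by (simp add: power_mult[symmetric] mult.commute)
    have "P (q ^ (2 ^ n))"
      by (rule desc[OF _ 1 2]) (use q in simp)
    then show ?case
      by (rule Suc.IH)
  qed simp
  have "eventually (\<lambda>n. P (q ^ (2 ^ n))) sequentially"
    using filterlim_iterated_square_at_0[OF q] ev by (auto simp: filterlim_iff)
  then obtain n where "P (q ^ (2 ^ n))"
    by (auto simp: eventually_sequentially)
  then show ?thesis
    by (rule *)
qed

section \<open>Behaviour of the theta series near q = 0, and nonvanishing of the null values\<close>

lemma Theta_unit_bound:
  assumes q: "norm q \<le> 1 / 2" and x: "norm x = 1"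
  shows "norm (Theta q x - 1) \<le> 4 * norm q"
proof -
  define S where "S y = (\<Sum>k. q ^ (Suc k ^ 2) * y ^ Suc k)" for y
  have bnd: "norm (S y) \<le> 2 * norm q" if "norm y = 1" for y
    unfolding S_def
  proof (rule norm_suminf_geometric_le(2))
    fix k
    have "norm (q ^ (Suc k ^ 2) * y ^ Suc k) = norm q ^ (Suc k ^ 2)"
      using that by (simp add: norm_mult norm_power)
    also have "\<dots> \<le> norm q ^ Suc k"
      using q by (intro power_decreasing) (auto simp: power2_eq_square)
    also have "\<dots> \<le> norm q * (1 / 2) ^ k"
      using q by (auto intro!: mult_left_mono power_mono)
    finally show "norm (q ^ (Suc k ^ 2) * y ^ Suc k) \<le> norm q * (1 / 2) ^ k" .
  qed
  have "x \<noteq> 0"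
    using x by auto
  have "summable (\<lambda>n. q ^ (n ^ 2) * x ^ n)"
    by (rule summable_norm_cancel[OF summable_theta_nat]) (use q in auto)
  then have "(\<Sum>n. q ^ (n ^ 2) * x ^ n) = 1 + S x"
    unfolding S_def by (subst suminf_split_head) simp_all
  then have "Theta q x = 1 + S x + S (1 / x)"
    using q \<open>x \<noteq> 0\<close> by (subst Theta_nat) (simp_all add: S_def del: power_Suc)
  then have "norm (Theta q x - 1) \<le> norm (S x) + norm (S (1 / x))"
    by (simp add: norm_triangle_ineq)
  then show ?thesis
    using bnd[OF x] bnd[of "1 / x"] x by (simp add: norm_divide)
qed

text \<open>The terms n = 0 and n = -1 give 1 and q / (q x) = 1/x; all others keep a power of q. The
  constant M makes the bound uniform for x in an annulus, as the limit of the derivative of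
  \<open>theta1\<close> requires.\<close>

lemma Theta_scaled_bound:
  assumes q: "q \<noteq> 0" "norm q * M \<le> 1 / 2" and M: "M \<ge> 1"
    and x: "x \<noteq> 0" "norm x \<le> M" "norm (1 / x) \<le> M"
  shows "norm (Theta q (q * x) - (1 + 1 / x)) \<le> 4 * M * norm q"
proof -
  have "norm q * 1 \<le> norm q * M"
    using M by (intro mult_left_mono) auto
  then have q1: "norm q \<le> 1 / 2"
    using q by linarith
  define S where "S = (\<Sum>k. q ^ (Suc k ^ 2) * (q * x) ^ Suc k)"
  define S' where "S' = (\<Sum>k. q ^ (Suc (Suc k) ^ 2) * (1 / (q * x)) ^ Suc (Suc k))"
  have S: "norm S \<le> 2 * norm q"
    unfolding S_def
  proof (rule norm_suminf_geometric_le(2))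
    fix k
    have "norm (q ^ (Suc k ^ 2) * (q * x) ^ Suc k) = norm q ^ (Suc k ^ 2 + Suc k) * norm x ^ Suc k"
      by (simp add: norm_mult norm_power power_mult_distrib power_add)
    also have "\<dots> \<le> norm q ^ Suc (Suc k) * M ^ Suc k"
      using q1 x by (intro mult_mono power_mono power_decreasing) (auto simp: power2_eq_square)
    also have "\<dots> = norm q * (norm q * M) ^ Suc k"
      by (simp add: power_mult_distrib)
    also have "\<dots> \<le> norm q * (1 / 2) ^ Suc k"
      using q M by (intro mult_left_mono power_mono) auto
    also have "\<dots> \<le> norm q * (1 / 2) ^ k"
      by (intro mult_left_mono power_decreasing) auto
    finally show "norm (q ^ (Suc k ^ 2) * (q * x) ^ Suc k) \<le> norm q * (1 / 2) ^ k" .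
  qed
  have S': "norm S' \<le> 2 * (M * norm q)"
    unfolding S'_def
  proof (rule norm_suminf_geometric_le(2))
    fix k
    \<comment> \<open>Dividing by (q x)^(k+2) uses up k + 2 of the exponent (k+2)^2 and leaves
      (k+2)(k+1), still at least k + 2.\<close>
    have e: "Suc (Suc k) ^ 2 = Suc (Suc k) * Suc k + Suc (Suc k)"
      by (simp add: power2_eq_square)
    have "norm (q ^ (Suc (Suc k) ^ 2) * (1 / (q * x)) ^ Suc (Suc k)) =
        norm q ^ (Suc (Suc k) * Suc k) * norm (1 / x) ^ Suc (Suc k)"
      unfolding e power_add using q by (simp add: norm_mult norm_power norm_divide field_simps)
    also have "\<dots> \<le> norm q ^ Suc (Suc k) * M ^ Suc (Suc k)"
      using q1 x by (intro mult_mono power_mono power_decreasing) auto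
    also have "\<dots> = M * norm q * (norm q * M) ^ Suc k"
      by (simp add: power_mult_distrib)
    also have "\<dots> \<le> M * norm q * (1 / 2) ^ Suc k"
      using q M by (intro mult_left_mono power_mono) auto
    also have "\<dots> \<le> M * norm q * (1 / 2) ^ k"
      using M by (intro mult_left_mono power_decreasing) auto
    finally show "norm (q ^ (Suc (Suc k) ^ 2) * (1 / (q * x)) ^ Suc (Suc k)) \<le> M * norm q * (1 / 2) ^ k" .
  qed
  have "summable (\<lambda>n. q ^ (n ^ 2) * (q * x) ^ n)" "summable (\<lambda>n. q ^ (Suc n ^ 2) * (1 / (q * x)) ^ Suc n)"
    by (rule summable_norm_cancel[OF summable_theta_nat], use q1 in force)
       (subst summable_Suc_iff, rule summable_norm_cancel[OF summable_theta_nat], use q1 in force)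
  then have "(\<Sum>n. q ^ (n ^ 2) * (q * x) ^ n) = 1 + S"
    "(\<Sum>n. q ^ (Suc n ^ 2) * (1 / (q * x)) ^ Suc n) = 1 / x + S'"
    unfolding S_def S'_def using q by (subst suminf_split_head; simp)+
  moreover have "norm q < 1" "q * x \<noteq> 0"
    using q1 q x by auto
  moreover from this have "Theta q (q * x) = (\<Sum>n. q ^ (n ^ 2) * (q * x) ^ n) +
      (\<Sum>n. q ^ (Suc n ^ 2) * (1 / (q * x)) ^ Suc n)"
    by (rule Theta_nat)
  ultimately have "Theta q (q * x) = (1 + S) + (1 / x + S')"
    by (simp only:)
  then have "norm (Theta q (q * x) - (1 + 1 / x)) = norm (S + S')"
    by simp
  also have "\<dots> \<le> norm S + norm S'"
    by (rule norm_triangle_ineq)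
  also have "\<dots> \<le> 2 * norm q + 2 * (M * norm q)"
    using S S' by simp
  also have "\<dots> \<le> 4 * M * norm q"
    using mult_right_mono[OF M, of "norm q"] by simp
  finally show ?thesis .
qed

lemma Theta_unit_tendsto:
  assumes "norm x = 1"
  shows "((\<lambda>q. Theta q x) \<longlongrightarrow> 1) (at 0)"
  by (rule tendsto_at_0_linear_bound[of "1 / 2" _ _ 4]) (use Theta_unit_bound assms in auto)

lemma Theta_self_tendsto: "((\<lambda>q. Theta q q) \<longlongrightarrow> 2) (at 0)"
  by (rule tendsto_at_0_linear_bound[of "1 / 2" _ _ 4]) (use Theta_scaled_bound[of _ 1 1] in auto)

text \<open>This null value comes first because its descent is self-contained: at q it divides the
  square of the same null value at q^2. The null value at 1 then follows from the same identity, and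
  the one at q needs that at 1.\<close>

lemma Theta_minus_1_nonzero:
  assumes "q \<noteq> 0" "norm q < 1"
  shows "Theta q (- 1) \<noteq> 0"
proof (rule square_descent[where P = "\<lambda>q. Theta q (- 1) \<noteq> 0"])
  show "eventually (\<lambda>q. Theta q (- 1) \<noteq> 0) (at 0)"
    using Theta_unit_tendsto[of "- 1"] by (intro tendsto_imp_eventually_ne) auto
  show "Theta q (- 1) \<noteq> 0" if "q \<noteq> 0" "norm q < 1" "Theta (q\<^sup>2) (- 1) \<noteq> 0" for q
  proof -
    have "Theta q 1 * Theta q (- 1) \<noteq> 0"
      using that by (simp add: Theta_1_mult_Theta_minus_1)
    then show ?thesis by simp
  qed
qed (rule assms)+

lemma Theta_1_nonzero:
  assumes "q \<noteq> 0" "norm q < 1"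
  shows "Theta q 1 \<noteq> 0"
proof -
  have "Theta (q\<^sup>2) (- 1) \<noteq> 0"
    using assms by (intro Theta_minus_1_nonzero) (auto simp: norm_power power_less_one_iff)
  then have "Theta q 1 * Theta q (- 1) \<noteq> 0"
    using assms by (simp add: Theta_1_mult_Theta_minus_1)
  then show ?thesis by simp
qed

lemma Theta_self_nonzero:
  assumes "q \<noteq> 0" "norm q < 1"
  shows "Theta q q \<noteq> 0"
proof (rule square_descent[where P = "\<lambda>q. Theta q q \<noteq> 0"])
  show "eventually (\<lambda>q. Theta q q \<noteq> 0) (at 0)"
    using Theta_self_tendsto by (intro tendsto_imp_eventually_ne) auto
  show "Theta q q \<noteq> 0" if "q \<noteq> 0" "norm q < 1" "Theta (q\<^sup>2) (q\<^sup>2) \<noteq> 0" for q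
  proof -
    have "Theta (q\<^sup>2) 1 \<noteq> 0"
      using that by (intro Theta_1_nonzero) (auto simp: norm_power power_less_one_iff)
    then have "(Theta q q)\<^sup>2 \<noteq> 0"
      using that by (simp add: Theta_self_power2)
    then show ?thesis by simp
  qed
qed (rule assms)+

section \<open>Evaluation of the Lambert series at x = 1\<close>

lemma Lambert_denominator_nonzero:
  fixes q :: complex
  assumes "q \<noteq> 0" "norm q < 1"
  shows "1 + q powi m \<noteq> 0"
proof
  assume "1 + q powi m = 0"
  then have "q powi m = - 1"
    by (simp add: add_eq_0_iff)
  then have *: "norm q powi m = 1"
    by (metis norm_minus_cancel norm_one norm_power_int)
  have "m = 0"
  proof (rule ccontr)
    assume "m \<noteq> 0"
    have "norm q powi \<bar>m\<bar> = 1"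
      using * by (cases "m \<ge> 0") (auto simp: power_int_minus)
    moreover have "norm q powi \<bar>m\<bar> < 1"
      using \<open>m \<noteq> 0\<close> assms by (simp add: power_int_nonneg_exp power_less_one_iff)
    ultimately show False by simp
  qed
  then show False
    using \<open>q powi m = - 1\<close> by simp
qed

text \<open>Even m reproduce the series with \<alpha> = 1 at nome q^2; odd m give the one whose
  \<alpha> equals the nome q^2. Taking x = 1 and x = -1 separates the two.\<close>

lemma Lambert_parity:
  assumes q: "q \<noteq> 0" "norm q < 1" and x: "norm x = 1"
  shows "Lambert q 1 x = Lambert (q\<^sup>2) 1 (x\<^sup>2) + q * x * Lambert (q\<^sup>2) (q\<^sup>2) (x\<^sup>2)"
proof -
  define f where "f m = q powi m / (1 + 1 * q powi (2 * m)) * x powi m" for m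
  have q2: "norm (q\<^sup>2) < 1" and x0: "x \<noteq> 0"
    using q x by (auto simp: norm_power power_less_one_iff)
  have pw: "(y\<^sup>2) powi k = y powi (2 * k)" for y :: complex and k
    using power_int_power[of y 2 k] by simp
  have U: "(UNIV :: int set) = range (\<lambda>k. 2 * k) \<union> range (\<lambda>k. 2 * k + 1)"
  proof -
    have "m \<in> range (\<lambda>k. 2 * k) \<union> range (\<lambda>k. 2 * k + 1)" for m :: int
      by (cases "even m") (auto elim!: evenE oddE)
    then show ?thesis by blast
  qed
  have "(f has_sum Lambert (q\<^sup>2) 1 (x\<^sup>2)) (range (\<lambda>k. 2 * k))"
  proof (subst has_sum_reindex)
    have "f \<circ> (\<lambda>k. 2 * k) = (\<lambda>k. (q\<^sup>2) powi k / (1 + 1 * (q\<^sup>2) powi (2 * k)) * (x\<^sup>2) powi k)"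
      by (simp add: f_def pw o_def)
    then show "((f \<circ> (\<lambda>k. 2 * k)) has_sum Lambert (q\<^sup>2) 1 (x\<^sup>2)) UNIV"
      using Lambert_summable[of "q\<^sup>2" 1 "x\<^sup>2"] q q2 x
      by (simp add: Lambert_def norm_power norm_mult power_less_one_iff)
  qed (auto simp: inj_on_def)
  moreover have "(f has_sum (q * x * Lambert (q\<^sup>2) (q\<^sup>2) (x\<^sup>2))) (range (\<lambda>k. 2 * k + 1))"
  proof (subst has_sum_reindex)
    have "f \<circ> (\<lambda>k. 2 * k + 1) =
        (\<lambda>k. q * x * ((q\<^sup>2) powi k / (1 + q\<^sup>2 * (q\<^sup>2) powi (2 * k)) * (x\<^sup>2) powi k))"
      using q x0 by (auto simp: f_def pw o_def power_int_add distrib_left mult_ac)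
    then show "((f \<circ> (\<lambda>k. 2 * k + 1)) has_sum (q * x * Lambert (q\<^sup>2) (q\<^sup>2) (x\<^sup>2))) UNIV"
      using has_sum_cmult_right[OF has_sum_infsum[OF Lambert_summable[of "q\<^sup>2" "q\<^sup>2" "x\<^sup>2"]], of "q * x"] q q2 x
      by (simp add: Lambert_def norm_power norm_mult power_less_one_iff)
  qed (auto simp: inj_on_def)
  ultimately have "(f has_sum (Lambert (q\<^sup>2) 1 (x\<^sup>2) + q * x * Lambert (q\<^sup>2) (q\<^sup>2) (x\<^sup>2)))
      (range (\<lambda>k. 2 * k) \<union> range (\<lambda>k. 2 * k + 1))"
    by (rule has_sum_Un_disjoint) (auto, presburger)
  then have "infsum f UNIV = Lambert (q\<^sup>2) 1 (x\<^sup>2) + q * x * Lambert (q\<^sup>2) (q\<^sup>2) (x\<^sup>2)"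
    using infsumI U by metis
  then show ?thesis
    unfolding Lambert_def f_def .
qed

lemma Lambert_1_1_tendsto: "((\<lambda>q. Lambert q 1 1) \<longlongrightarrow> 1 / 2) (at 0)"
proof (rule tendsto_at_0_linear_bound[of "1 / 2" _ _ 8])
  fix q :: complex
  assume q: "q \<noteq> 0" "norm q \<le> 1 / 2"
  define S where "S = (\<Sum>k. q ^ Suc k / (1 + q ^ (2 * Suc k)))"
  have bnd: "norm (q ^ Suc k / (1 + q ^ (2 * Suc k))) \<le> 2 * norm q * (1 / 2) ^ k" for k
  proof -
    have "norm (q ^ (2 * Suc k)) \<le> (1 / 2) ^ (2 * Suc k)"
      unfolding norm_power using q by (intro power_mono) auto
    also have "\<dots> \<le> (1 / 2) ^ 1"
      by (intro power_decreasing) auto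
    finally have "norm (1 + q ^ (2 * Suc k)) \<ge> 1 / 2"
      using norm_diff_ineq[of 1 "q ^ (2 * Suc k)"] by simp
    then have "norm q ^ Suc k / norm (1 + q ^ (2 * Suc k)) \<le> norm q ^ Suc k / (1 / 2)"
      by (intro divide_left_mono) auto
    also have "\<dots> \<le> 2 * norm q * (1 / 2) ^ k"
      using q by (auto intro!: mult_left_mono power_mono)
    finally show ?thesis
      by (simp only: norm_divide norm_power)
  qed
  have S: "norm S \<le> 2 * (2 * norm q)" and sm: "summable (\<lambda>k. q ^ Suc k / (1 + q ^ (2 * Suc k)))"
    using norm_suminf_geometric_le[OF bnd] by (auto simp: S_def)
  have "(\<Sum>k. q ^ k / (1 + q ^ (2 * k))) = 1 / 2 + S"
    using suminf_split_head[of "\<lambda>k. q ^ k / (1 + q ^ (2 * k))"] summable_Suc_iff[of "\<lambda>k. q ^ k / (1 + q ^ (2 * k))"] sm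
    by (simp add: S_def)
  then have "Lambert q 1 1 = 1 / 2 + S + S"
    using Lambert_nat[of q 1 1] q by (simp add: S_def add.commute)
  then have "norm (Lambert q 1 1 - 1 / 2) \<le> norm S + norm S"
    by (simp add: norm_triangle_ineq)
  then show "norm (Lambert q 1 1 - 1 / 2) \<le> 8 * norm q"
    using S by simp
qed auto

text \<open>The unknown constant of the theta quotient is eliminated between x = 1 and x =
  -1.\<close>

lemma Lambert_1_minus_1:
  assumes q: "q \<noteq> 0" "norm q < 1"
  shows "Lambert q 1 (- 1) * (Theta q 1)\<^sup>2 = Lambert q 1 1 * (Theta q (- 1))\<^sup>2"
proof -
  obtain c where c: "\<And>x. norm q < norm x \<Longrightarrow> norm (q * x) < 1 \<Longrightarrow>
      Lambert q 1 x * Theta q (- x) = c * Theta q (1 * x)"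
    using Lambert_Theta_exists[of q 1] Lambert_denominator_nonzero[OF q] q by auto
  have "Lambert q 1 1 * Theta q (- 1) = c * Theta q 1" "Lambert q 1 (- 1) * Theta q 1 = c * Theta q (- 1)"
    using c[of 1] c[of "- 1"] q by auto
  then have "Lambert q 1 (- 1) * Theta q 1 * Theta q 1 = Lambert q 1 1 * Theta q (- 1) * Theta q (- 1)"
    by (simp only: mult_ac)
  then show ?thesis
    by (simp add: power2_eq_square mult.assoc)
qed

text \<open>Jacobi's two-squares formula in Lambert form. The mean over x = 1 and x = -1 carries the
  series from q to q^2, and by the preceding lemma it scales exactly as the mean of the squares of
  the null values at 1 and -1 does.\<close>

lemma Lambert_1_1:
  assumes q: "q \<noteq> 0" "norm q < 1"
  shows "Lambert q 1 1 = (Theta q 1)\<^sup>2 / 2"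
proof -
  have "Lambert q 1 1 / (Theta q 1)\<^sup>2 = (1 / 2) / 1\<^sup>2"
  proof (rule square_invariant_eq_limit[where R = "\<lambda>q. Lambert q 1 1 / (Theta q 1)\<^sup>2"])
    show "((\<lambda>q. Lambert q 1 1 / (Theta q 1)\<^sup>2) \<longlongrightarrow> (1 / 2) / 1\<^sup>2) (at 0)"
      by (intro tendsto_intros Lambert_1_1_tendsto Theta_unit_tendsto) auto
    fix q :: complex
    assume q: "q \<noteq> 0" "norm q < 1"
    have nz: "Theta q 1 \<noteq> 0" "Theta (q\<^sup>2) 1 \<noteq> 0"
      using Theta_1_nonzero[of q] Theta_1_nonzero[of "q\<^sup>2"] q by (auto simp: norm_power power_less_one_iff)
    have "2 * Lambert (q\<^sup>2) 1 1 = Lambert q 1 1 + Lambert q 1 (- 1)"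
      using Lambert_parity[OF q, of 1] Lambert_parity[OF q, of "- 1"] by simp
    then have "2 * Lambert (q\<^sup>2) 1 1 * (Theta q 1)\<^sup>2 = Lambert q 1 1 * ((Theta q 1)\<^sup>2 + (Theta q (- 1))\<^sup>2)"
      using Lambert_1_minus_1[OF q] by (simp only: distrib_left distrib_right)
    also have "(Theta q 1)\<^sup>2 + (Theta q (- 1))\<^sup>2 = 2 * (Theta (q\<^sup>2) 1)\<^sup>2"
      using Theta_1_power2[of q] Theta_minus_1_power2[of q] q by simp
    finally show "Lambert q 1 1 / (Theta q 1)\<^sup>2 = Lambert (q\<^sup>2) 1 1 / (Theta (q\<^sup>2) 1)\<^sup>2"
      using nz by (simp add: field_simps)
  qed (use q in auto)
  then show ?thesis
    using Theta_1_nonzero[OF q] by (simp add: field_simps)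
qed

lemma Lambert_self_1:
  assumes q: "q \<noteq> 0" "norm q < 1"
  shows "Lambert q q 1 = (Theta q q)\<^sup>2 / 2"
proof -
  \<comment> \<open>The odd terms at nome p form the series with \<alpha> = q at nome q, so the
    already known value at nome p determines it. Either square root would do.\<close>
  define p where "p = csqrt q"
  have p2: "p\<^sup>2 = q"
    by (simp add: p_def)
  have p: "p \<noteq> 0" "norm p < 1"
    using q unfolding p2[symmetric] by (auto simp: norm_power power_less_one_iff)
  have nz: "Theta p 1 \<noteq> 0"
    using Theta_1_nonzero[OF p] .
  have "2 * p * Lambert q q 1 = Lambert p 1 1 - Lambert p 1 (- 1)"
    using Lambert_parity[OF p, of 1] Lambert_parity[OF p, of "- 1"] by (simp add: p2)
  then have "2 * p * Lambert q q 1 * (Theta p 1)\<^sup>2 = Lambert p 1 1 * ((Theta p 1)\<^sup>2 - (Theta p (- 1))\<^sup>2)"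
    using Lambert_1_minus_1[OF p] by (simp only: left_diff_distrib right_diff_distrib)
  also have "(Theta p 1)\<^sup>2 - (Theta p (- 1))\<^sup>2 = 2 * p * (Theta q q)\<^sup>2"
    using Theta_1_power2[of p] Theta_minus_1_power2[of p] p by (simp add: p2)
  finally show ?thesis
    using nz p by (simp add: Lambert_1_1[OF p] field_simps)
qed

lemma Lambert_self_eq_Theta_quotient:
  assumes q: "q \<noteq> 0" "norm q < 1" and x: "norm q < norm x" "norm (q * x) < 1"
  shows "Lambert q q x * Theta q (- x) = Theta q q * Theta q (- 1) / 2 * Theta q (q * x)"
proof -
  have "1 + q * q powi (2 * m) \<noteq> 0" for m
    using Lambert_denominator_nonzero[OF q, of "2 * m + 1"] q by (simp add: power_int_add mult.commute)
  then obtain c where c: "\<And>x. norm q < norm x \<Longrightarrow> norm (q * x) < 1 \<Longrightarrow>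
      Lambert q q x * Theta q (- x) = c * Theta q (q * x)"
    using Lambert_Theta_exists[of q q] q by auto
  have "(Theta q q)\<^sup>2 / 2 * Theta q (- 1) = c * Theta q q"
    using c[of 1] q by (simp add: Lambert_self_1)
  then have "c = Theta q q * Theta q (- 1) / 2"
    using Theta_self_nonzero[OF q] by (simp add: power2_eq_square)
  then show ?thesis
    using c[OF x] by simp
qed

section \<open>Theta functions of a complex argument\<close>

lemma Theta_holomorphic:
  assumes q: "norm q < 1"
  shows "Theta q holomorphic_on - {0}"
proof -
  define p where "p = (\<lambda>y. \<Sum>n. q ^ (n ^ 2) * y ^ n)"
  have sm: "summable (\<lambda>n. q ^ (n ^ 2) * y ^ n)" for y
    by (rule summable_norm_cancel[OF summable_theta_nat[OF q]])
  have p: "p holomorphic_on A" for A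
    unfolding p_def holomorphic_on_def field_differentiable_def
    using termdiffs_strong_converges_everywhere[OF sm] has_field_derivative_at_within by blast
  \<comment> \<open>Both halves contain the term n = 0, hence the subtraction of 1.\<close>
  have "(\<lambda>x. p x + (p (1 / x) - 1)) holomorphic_on - {0}"
    by (intro holomorphic_intros p holomorphic_on_compose[of "\<lambda>x. 1 / x" _ p, unfolded o_def]) auto
  moreover have "p x + (p (1 / x) - 1) = Theta q x" if "x \<in> - {0}" for x
  proof -
    have "(\<Sum>n. q ^ (Suc n ^ 2) * (1 / x) ^ Suc n) = p (1 / x) - 1"
      unfolding p_def by (subst suminf_split_head[OF sm]) simp
    then show ?thesis
      using Theta_nat[OF q, of x] that by (simp only: p_def) simp
  qed
  ultimately show ?thesis
    by (rule holomorphic_transform)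
qed

lemma Theta_compose_holomorphic [holomorphic_intros]:
  assumes "norm q < 1" "f holomorphic_on A" "\<And>z. z \<in> A \<Longrightarrow> f z \<noteq> 0"
  shows "(\<lambda>z. Theta q (f z)) holomorphic_on A"
  by (rule holomorphic_on_compose_gen[OF assms(2) Theta_holomorphic[OF assms(1)], unfolded o_def])
    (use assms(3) in auto)

text \<open>With u = i z the classical function is -i q^(1/4) times this one. The omitted fourth
  root reappears as the bare q in the addition formula with the squares of
  \<open>theta1\<close>.\<close>

definition theta1 :: "complex \<Rightarrow> complex \<Rightarrow> complex" where
  "theta1 q u = exp u * Theta q (- q * exp (2 * u))"

definition theta2 :: "complex \<Rightarrow> complex \<Rightarrow> complex" where
  "theta2 q u = exp u * Theta q (q * exp (2 * u))"

definition theta3 :: "complex \<Rightarrow> complex \<Rightarrow> complex" where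
  "theta3 q u = Theta q (exp (2 * u))"

definition theta4 :: "complex \<Rightarrow> complex \<Rightarrow> complex" where
  "theta4 q u = Theta q (- exp (2 * u))"

lemma theta_holomorphic:
  assumes "q \<noteq> 0" "norm q < 1"
  shows "theta1 q holomorphic_on A" "theta2 q holomorphic_on A"
    "theta3 q holomorphic_on A" "theta4 q holomorphic_on A"
  unfolding theta1_def theta2_def theta3_def theta4_def
  using assms by (auto intro!: holomorphic_intros)

lemma theta_0:
  "q \<noteq> 0 \<Longrightarrow> theta1 q 0 = 0" "theta2 q 0 = Theta q q" "theta3 q 0 = Theta q 1" "theta4 q 0 = Theta q (- 1)"
  by (simp_all add: theta1_def theta2_def theta3_def theta4_def Theta_neg_self_eq_0)

lemma theta_minus:
  assumes q: "q \<noteq> 0"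
  shows "theta1 q (- u) = - theta1 q u" "theta2 q (- u) = theta2 q u"
    "theta3 q (- u) = theta3 q u" "theta4 q (- u) = theta4 q u"
proof -
  define x where "x = exp (2 * u)"
  have "exp (- u) * x = exp u"
    by (simp add: x_def flip: exp_add)
  moreover have "x \<noteq> 0" "exp (- (2 * u)) = 1 / x"
    by (simp_all add: x_def exp_minus inverse_eq_divide)
  ultimately have x: "x \<noteq> 0" "exp (- (2 * u)) = 1 / x" "exp (- u) * x = exp u"
    by blast+
  have "Theta q (- q * (1 / x)) = - x * Theta q (- q * x)"
    using Theta_inverse[of q "- (x / q)"] Theta_shift[of q "- (x / q)"] q x
    by (simp add: power2_eq_square)
  then show "theta1 q (- u) = - theta1 q u"
    using x by (simp add: theta1_def flip: x_def)
  have "Theta q (q * (1 / x)) = x * Theta q (q * x)"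
    using Theta_inverse[of q "x / q"] Theta_shift[of q "x / q"] q x
    by (simp add: power2_eq_square)
  then show "theta2 q (- u) = theta2 q u"
    using x by (simp add: theta2_def flip: x_def)
  show "theta3 q (- u) = theta3 q u" "theta4 q (- u) = theta4 q u"
    using x Theta_inverse[of q x] Theta_inverse[of q "- x"]
    by (simp_all add: theta3_def theta4_def flip: x_def)
qed

lemma theta_landen:
  assumes "q \<noteq> 0" "norm q < 1"
  shows "theta1 q u * theta2 q u = theta1 (q\<^sup>2) (2 * u) * Theta (q\<^sup>2) (- 1)"
proof -
  have "exp u * exp u = exp (2 * u)" "(exp (2 * u))\<^sup>2 = exp (2 * (2 * u))"
    by (simp_all add: power2_eq_square flip: exp_add)
  then show ?thesis
    using Theta_landen[of q "exp (2 * u)"] assms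
    by (simp add: theta1_def theta2_def mult_ac)
qed

lemma theta_addition:
  assumes q: "q \<noteq> 0" "norm q < 1"
  shows "theta2 q (u + v) * theta4 q (u - v) * Theta q q * Theta q (- 1) =
      theta2 q u * theta4 q u * theta2 q v * theta4 q v + theta1 q u * theta3 q u * theta1 q v * theta3 q v"
    and "theta4 q (u + v) * theta4 q (u - v) * (Theta q (- 1))\<^sup>2 =
      (theta4 q u)\<^sup>2 * (theta4 q v)\<^sup>2 - q * (theta1 q u)\<^sup>2 * (theta1 q v)\<^sup>2"
proof -
  define x y where "x = exp (2 * u)" and "y = exp (2 * v)"
  have e: "exp (2 * (u + v)) = x * y" "exp (2 * (u - v)) = x / y" "x \<noteq> 0" "y \<noteq> 0"
    by (simp_all add: x_def y_def distrib_left right_diff_distrib exp_add exp_diff)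
  have sq: "(exp u)\<^sup>2 = x" "(exp v)\<^sup>2 = y"
    by (simp_all add: x_def y_def power2_eq_square flip: exp_add)
  have "exp (u + v) * (Theta q (q * (x * y)) * Theta q (- (x / y)) * Theta q q * Theta q (- 1)) =
      exp u * exp v * (Theta q (q * x) * Theta q (- x) * Theta q (q * y) * Theta q (- y) +
    Theta q (- q * x) * Theta q x * Theta q (- q * y) * Theta q y)"
    using Theta_addition_numerator[of q x y] q e by (simp add: exp_add)
  then show "theta2 q (u + v) * theta4 q (u - v) * Theta q q * Theta q (- 1) =
      theta2 q u * theta4 q u * theta2 q v * theta4 q v + theta1 q u * theta3 q u * theta1 q v * theta3 q v"
    unfolding theta1_def theta2_def theta3_def theta4_def e x_def[symmetric] y_def[symmetric]
    by (simp add: algebra_simps)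
  show "theta4 q (u + v) * theta4 q (u - v) * (Theta q (- 1))\<^sup>2 =
      (theta4 q u)\<^sup>2 * (theta4 q v)\<^sup>2 - q * (theta1 q u)\<^sup>2 * (theta1 q v)\<^sup>2"
    using Theta_addition_denominator[of q x y] q e
    unfolding theta1_def theta4_def e x_def[symmetric] y_def[symmetric] power_mult_distrib sq
    by (simp add: mult_ac)
qed

text \<open>As q tends to 0, \<open>theta1 q\<close> tends to 2 sinh u uniformly on the unit ball,
  so by Weierstrass the derivatives at 0 converge as well.\<close>

lemma theta1_deriv_tendsto: "((\<lambda>q. deriv (theta1 q) 0) \<longlongrightarrow> 2) (at 0)"
proof -
  \<comment> \<open>Bounds |exp(2u)| and |exp(-2u)| when |Re u| is at most 1.\<close>
  define M :: real where "M = exp 2"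
  have M: "M \<ge> 1" by (simp add: M_def)
  define C where "C = exp 1 * (4 * M)"
  have bound: "norm (theta1 q u - (exp u - exp (- u))) \<le> C * norm q"
    if "u \<in> ball 0 1" "q \<noteq> 0" "norm q * M \<le> 1 / 2" for q u
  proof -
    have re: "\<bar>Re u\<bar> \<le> 1"
      using that abs_Re_le_cmod[of u] by simp
    define x where "x = - exp (2 * u)"
    have x: "x \<noteq> 0" "norm x \<le> M" "norm (1 / x) \<le> M"
      using re by (auto simp: x_def M_def norm_divide simp flip: exp_minus inverse_eq_divide)
    have "exp u * (1 + 1 / x) = exp u - exp (- u)"
    proof -
      have "exp u / exp (2 * u) = exp (- u)"
        by (simp flip: exp_diff)
      then show ?thesis
        by (simp add: x_def right_diff_distrib)
    qed
    then have "theta1 q u - (exp u - exp (- u)) = exp u * (Theta q (q * x) - (1 + 1 / x))"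
      by (simp add: theta1_def x_def right_diff_distrib)
    also have "norm \<dots> \<le> exp 1 * (4 * M * norm q)"
      unfolding norm_mult using re Theta_scaled_bound[OF that(2,3) M x]
      by (intro mult_mono) auto
    finally show ?thesis
      by (simp add: C_def)
  qed
  have norm_lim: "((\<lambda>q :: complex. norm q) \<longlongrightarrow> 0) (at 0)"
    by (intro tendsto_norm_zero tendsto_ident_at)
  have small: "eventually (\<lambda>q :: complex. q \<noteq> 0 \<and> norm q * M \<le> 1 / 2 \<and> norm q < 1) (at 0)"
  proof -
    have "eventually (\<lambda>q :: complex. norm q * M < 1 / 2) (at 0)"
      using tendsto_mult_left_zero[OF norm_lim, of M] by (rule order_tendstoD) auto
    moreover have "eventually (\<lambda>q :: complex. norm q < 1) (at 0)"
      using norm_lim by (rule order_tendstoD) auto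
    ultimately show ?thesis
      using eventually_neq_at_within[of 0] by eventually_elim auto
  qed
  have "uniform_limit (ball 0 1) theta1 (\<lambda>u. exp u - exp (- u)) (at 0)"
  proof (rule uniform_limitI)
    fix e :: real
    assume e: "e > 0"
    have "eventually (\<lambda>q :: complex. C * norm q < e) (at 0)"
      using tendsto_mult_right_zero[OF norm_lim, of C] by (rule order_tendstoD) (use e in auto)
    with small show "eventually (\<lambda>q. \<forall>u\<in>ball 0 1. dist (theta1 q u) (exp u - exp (- u)) < e) (at 0)"
      by eventually_elim (use bound in \<open>force simp: dist_norm\<close>)
  qed
  moreover have "eventually (\<lambda>q. theta1 q holomorphic_on ball 0 1) (at 0)"
    using small by eventually_elim (auto intro: theta_holomorphic)
  ultimately have "((\<lambda>q. (deriv ^^ 1) (theta1 q) 0) \<longlongrightarrow> (deriv ^^ 1) (\<lambda>u. exp u - exp (- u)) 0) (at 0)"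
    by (rule higher_deriv_complex_uniform_limit) auto
  moreover have "deriv (\<lambda>u. exp u - exp (- u)) (0 :: complex) = 2"
    by (rule DERIV_imp_deriv) (auto intro!: derivative_eq_intros)
  ultimately show ?thesis
    by simp
qed

lemma theta1_deriv_landen:
  assumes q: "q \<noteq> 0" "norm q < 1"
  shows "deriv (theta1 q) 0 * Theta q q = 2 * deriv (theta1 (q\<^sup>2)) 0 * Theta (q\<^sup>2) (- 1)"
proof -
  have q2: "q\<^sup>2 \<noteq> 0" "norm (q\<^sup>2) < 1"
    using q by (auto simp: norm_power power_less_one_iff)
  have d: "(f has_field_derivative deriv f z) (at z)" if "f holomorphic_on UNIV" for f and z :: complex
    by (rule holomorphic_derivI[OF that]) auto
  note d1 = d[OF theta_holomorphic(1)[OF q]] and d2 = d[OF theta_holomorphic(2)[OF q]]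
    and d1' = d[OF theta_holomorphic(1)[OF q2]]
  have "((\<lambda>u. theta1 q u * theta2 q u) has_field_derivative (deriv (theta1 q) 0 * Theta q q)) (at 0)"
    using DERIV_mult[OF d1[of 0] d2[of 0]] q by (simp add: theta_0)
  moreover have "((\<lambda>u. theta1 (q\<^sup>2) (2 * u)) has_field_derivative deriv (theta1 (q\<^sup>2)) 0 * 2) (at 0)"
    by (rule DERIV_chain2[where f = "theta1 (q\<^sup>2)" and g = "\<lambda>u. 2 * u"])
      (use d1'[of 0] in \<open>auto intro!: derivative_eq_intros\<close>)
  then have "((\<lambda>u. theta1 (q\<^sup>2) (2 * u) * Theta (q\<^sup>2) (- 1)) has_field_derivative
      (2 * deriv (theta1 (q\<^sup>2)) 0 * Theta (q\<^sup>2) (- 1))) (at 0)"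
    using DERIV_cmult_right by (metis mult.commute)
  ultimately show ?thesis
    by (simp add: theta_landen[OF q] DERIV_unique)
qed

theorem jacobi_derivative_formula:
  assumes q: "q \<noteq> 0" "norm q < 1"
  shows "deriv (theta1 q) 0 = Theta q q * Theta q 1 * Theta q (- 1)"
proof -
  define R where "R = (\<lambda>q. deriv (theta1 q) 0 / (Theta q q * Theta q 1 * Theta q (- 1)))"
  have "R q = 2 / (2 * 1 * 1)"
  proof (rule square_invariant_eq_limit[where R = R])
    show "(R \<longlongrightarrow> 2 / (2 * 1 * 1)) (at 0)"
      unfolding R_def
      by (intro tendsto_intros theta1_deriv_tendsto Theta_self_tendsto Theta_unit_tendsto) auto
    fix q :: complex
    assume q: "q \<noteq> 0" "norm q < 1"
    then have q2: "q\<^sup>2 \<noteq> 0" "norm (q\<^sup>2) < 1"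
      by (auto simp: norm_power power_less_one_iff)
    define d d' t t2 t3 t4 where defs: "d = deriv (theta1 q) 0" "d' = deriv (theta1 (q\<^sup>2)) 0" "t = Theta q q"
      "t2 = Theta (q\<^sup>2) (q\<^sup>2)" "t3 = Theta (q\<^sup>2) 1" "t4 = Theta (q\<^sup>2) (- 1)"
    have nz: "t \<noteq> 0" "t2 \<noteq> 0" "t3 \<noteq> 0" "t4 \<noteq> 0"
      using q q2 by (auto simp: defs Theta_self_nonzero Theta_1_nonzero Theta_minus_1_nonzero)
    have 1: "Theta q 1 * Theta q (- 1) = t4\<^sup>2" "t\<^sup>2 = 2 * t2 * t3"
      using Theta_1_mult_Theta_minus_1[of q] Theta_self_power2[of q] q by (auto simp: defs)
    have "R q = d / (t * t4\<^sup>2)"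
      unfolding R_def 1(1)[symmetric] by (simp add: defs mult.assoc)
    \<comment> \<open>Enlarging by t brings both parts to nome q^2: d t is the derivative of the
      Landen identity at 0, and t^2 is a duplication identity.\<close>
    also have "\<dots> = d * t / (t\<^sup>2 * t4\<^sup>2)"
      using nz by (simp add: power2_eq_square)
    also have "d * t = 2 * d' * t4"
      using theta1_deriv_landen[OF q] by (simp add: defs)
    also have "2 * d' * t4 / (t\<^sup>2 * t4\<^sup>2) = d' / (t2 * t3 * t4)"
      unfolding 1(2) using nz by (simp add: power2_eq_square)
    finally show "R q = R (q\<^sup>2)"
      by (simp add: R_def defs)
  qed (rule q)+
  then show ?thesis
    using Theta_self_nonzero[OF q] Theta_1_nonzero[OF q] Theta_minus_1_nonzero[OF q]
    by (simp add: R_def)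
qed

text \<open>Up to scaling the function \<open>cn\<close> at imaginary argument. The factor exp u
  turns the exponents 2m into the odd numbers 2m + 1, the bases of the powers in
  \<open>Ttilde\<close>.\<close>

definition Lambert_fun :: "complex \<Rightarrow> complex \<Rightarrow> complex" where
  "Lambert_fun q u = exp u * Lambert q q (exp (2 * u))"

lemma Lambert_fun_addition:
  assumes q: "q \<noteq> 0" "norm q < 1"
    and uv: "norm q < norm (exp (2 * (u + v)))" "norm (q * exp (2 * (u + v))) < 1"
      "norm q < norm (exp (2 * (u - v)))" "norm (q * exp (2 * (u - v))) < 1"
  shows "(Lambert_fun q (u + v) - Lambert_fun q (u - v)) *
      ((theta4 q u)\<^sup>2 * (theta4 q v)\<^sup>2 - q * (theta1 q u)\<^sup>2 * (theta1 q v)\<^sup>2) =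
    (Theta q (- 1))\<^sup>2 * (theta1 q u * theta3 q u) * (theta1 q v * theta3 q v)"
proof -
  define a b where "a = Theta q q" and "b = Theta q (- 1)"
  have nz: "a \<noteq> 0" "b \<noteq> 0"
    using q by (auto simp: a_def b_def Theta_self_nonzero Theta_minus_1_nonzero)
  have L: "Lambert_fun q w * theta4 q w = a * b / 2 * theta2 q w"
    if "norm q < norm (exp (2 * w))" "norm (q * exp (2 * w)) < 1" for w
    using Lambert_self_eq_Theta_quotient[OF q that]
    by (simp add: Lambert_fun_def theta4_def theta2_def a_def b_def mult_ac)
  define P where "P = theta1 q u * theta3 q u * theta1 q v * theta3 q v"
  define Q where "Q = theta2 q u * theta4 q u * theta2 q v * theta4 q v"
  have p: "theta2 q (u + v) * theta4 q (u - v) * a * b = Q + P"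
    using theta_addition(1)[OF q, of u v] by (simp add: a_def b_def P_def Q_def)
  \<comment> \<open>Replacing v by -v flips only \<open>P\<close>, since \<open>theta1\<close> is
    odd and the other three are even; the difference of the two formulas therefore isolates 2
    \<open>P\<close>.\<close>
  have m: "theta2 q (u - v) * theta4 q (u + v) * a * b = Q - P"
    using theta_addition(1)[OF q, of u "- v"] q by (simp add: a_def b_def P_def Q_def theta_minus)
  have "(Lambert_fun q (u + v) - Lambert_fun q (u - v)) * (theta4 q (u + v) * theta4 q (u - v)) =
      (Lambert_fun q (u + v) * theta4 q (u + v)) * theta4 q (u - v) -
      (Lambert_fun q (u - v) * theta4 q (u - v)) * theta4 q (u + v)"
    by (simp add: algebra_simps)
  also have "\<dots> = ((theta2 q (u + v) * theta4 q (u - v) * a * b) - (theta2 q (u - v) * theta4 q (u + v) * a * b)) / 2"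
    unfolding L[OF uv(1,2)] L[OF uv(3,4)] by (simp add: field_simps)
  also have "\<dots> = P"
    unfolding p m by simp
  finally have "(Lambert_fun q (u + v) - Lambert_fun q (u - v)) * (theta4 q (u + v) * theta4 q (u - v) * b\<^sup>2) = b\<^sup>2 * P"
    by (simp add: mult_ac)
  then show ?thesis
    unfolding b_def theta_addition(2)[OF q] by (simp add: P_def mult_ac)
qed

section \<open>Hankel determinants from addition formulas\<close>

text \<open>The power series of s^N starts at order N, and one order later after a factor g with
  g(0) = 0. The three parts serve to discard the remainder of the geometric sum, to make L
  triangular, and to give its diagonal.\<close>

lemma higher_deriv_mult_power_zero:
  fixes g s :: "complex \<Rightarrow> complex"
  assumes A: "open A" "0 \<in> A" and holo: "g holomorphic_on A" "s holomorphic_on A" and s: "s 0 = 0"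
  shows "k < N \<Longrightarrow> (deriv ^^ k) (\<lambda>u. g u * s u ^ N) 0 = 0"
    and "g 0 = 0 \<Longrightarrow> k \<le> N \<Longrightarrow> (deriv ^^ k) (\<lambda>u. g u * s u ^ N) 0 = 0"
    and "g 0 = 0 \<Longrightarrow> (deriv ^^ Suc N) (\<lambda>u. g u * s u ^ N) 0 = fact (Suc N) * deriv g 0 * deriv s 0 ^ N"
proof -
  define F G where "F = fps_expansion s 0" and "G = fps_expansion g 0"
  have F: "s has_fps_expansion F" and G: "g has_fps_expansion G"
    unfolding F_def G_def using A holo by auto
  have GF: "(\<lambda>u. g u * s u ^ N) has_fps_expansion G * F ^ N"
    by (intro fps_expansion_intros F G)
  have D: "(deriv ^^ k) (\<lambda>u. g u * s u ^ N) 0 = fact k * (\<Sum>i=0..k. fps_nth G i * fps_nth (F ^ N) (k - i))" for k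
    using fps_nth_fps_expansion[OF GF, of k] by (simp add: fps_mult_nth)
  have F0: "fps_nth F 0 = 0" and F1: "fps_nth F 1 = deriv s 0"
    using fps_nth_fps_expansion[OF F, of 0] fps_nth_fps_expansion[OF F, of 1] s by simp_all
  have G0: "fps_nth G 0 = g 0" and G1: "fps_nth G 1 = deriv g 0"
    using fps_nth_fps_expansion[OF G, of 0] fps_nth_fps_expansion[OF G, of 1] by simp_all
  have z: "fps_nth (F ^ N) n = 0" if "n < N" for n
    using startsby_zero_power_prefix[OF F0] that by blast
  show "k < N \<Longrightarrow> (deriv ^^ k) (\<lambda>u. g u * s u ^ N) 0 = 0"
    unfolding D by (auto intro!: sum.neutral simp: z)
  show "(deriv ^^ k) (\<lambda>u. g u * s u ^ N) 0 = 0" if "g 0 = 0" "k \<le> N"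
  proof -
    have "fps_nth G i * fps_nth (F ^ N) (k - i) = 0" if "i \<in> {0..k}" for i
      using that \<open>k \<le> N\<close> \<open>g 0 = 0\<close> by (cases "i = 0") (auto simp: G0 z)
    then have "(\<Sum>i=0..k. fps_nth G i * fps_nth (F ^ N) (k - i)) = 0"
      by (intro sum.neutral) blast
    then show ?thesis
      unfolding D by simp
  qed
  show "(deriv ^^ Suc N) (\<lambda>u. g u * s u ^ N) 0 = fact (Suc N) * deriv g 0 * deriv s 0 ^ N" if "g 0 = 0"
  proof -
    have "(\<Sum>i=0..Suc N. fps_nth G i * fps_nth (F ^ N) (Suc N - i)) =
        (\<Sum>i\<in>{1}. fps_nth G i * fps_nth (F ^ N) (Suc N - i))"
    proof (rule sum.mono_neutral_right)
      show "\<forall>i\<in>{0..Suc N} - {1}. fps_nth G i * fps_nth (F ^ N) (Suc N - i) = 0"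
      proof
        fix i assume "i \<in> {0..Suc N} - {1}"
        then have "i = 0 \<or> Suc N - i < N" by auto
        then show "fps_nth G i * fps_nth (F ^ N) (Suc N - i) = 0"
          using \<open>g 0 = 0\<close> by (auto simp: G0 z)
      qed
    qed auto
    also have "\<dots> = deriv g 0 * deriv s 0 ^ N"
      using startsby_zero_power_nth_same[OF F0, of N] by (simp add: G1[simplified] F1[simplified])
    finally show ?thesis
      unfolding D by (simp only: mult.assoc)
  qed
qed

lemma higher_deriv_sum:
  fixes f :: "'i \<Rightarrow> complex \<Rightarrow> complex"
  assumes "open A" "z \<in> A" "\<And>i. i \<in> I \<Longrightarrow> f i holomorphic_on A"
  shows "(deriv ^^ k) (\<lambda>u. \<Sum>i\<in>I. f i u) z = (\<Sum>i\<in>I. (deriv ^^ k) (f i) z)"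
  using assms(3)
proof (induction I rule: infinite_finite_induct)
  case (insert i I)
  have "(deriv ^^ k) (\<lambda>u. f i u + (\<Sum>i\<in>I. f i u)) z = (deriv ^^ k) (f i) z + (deriv ^^ k) (\<lambda>u. \<Sum>i\<in>I. f i u) z"
    by (rule higher_deriv_add[of _ A]) (use assms insert in \<open>auto intro!: holomorphic_intros\<close>)
  then show ?case
    using insert by simp
qed auto

text \<open>An addition formula of this shape is an \<open>LDL\<^sup>T\<close> decomposition of the Hankel matrix of
  the even derivatives of \<open>f\<close>: the functions \<open>S s\<^sup>2\<^sup>m\<close> vanish to order \<open>2m + 1\<close> at \<open>0\<close>.\<close>

lemma hankel_decomposition:
  fixes f S s :: "complex \<Rightarrow> complex"
  assumes r: "r > 0"
    and holo: "f holomorphic_on ball 0 (2 * r)" "S holomorphic_on ball 0 r" "s holomorphic_on ball 0 r"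
    and s: "s 0 = 0"
    and add: "\<And>u v. u \<in> ball 0 r \<Longrightarrow> v \<in> ball 0 r \<Longrightarrow>
       (f (u + v) - f (u - v)) * (1 - p * (s u)\<^sup>2 * (s v)\<^sup>2) = C * S u * S v"
    and kl: "odd l" "k < 2 * n"
  shows "2 * (deriv ^^ (k + l)) f 0 = (\<Sum>m<n. C * p ^ m * (deriv ^^ k) (\<lambda>u. S u * s u ^ (2 * m)) 0 *
    (deriv ^^ l) (\<lambda>u. S u * s u ^ (2 * m)) 0)"
proof -
  define \<phi> where "\<phi> = (\<lambda>m u. S u * s u ^ (2 * m))"
  have \<phi>: "\<phi> m holomorphic_on ball 0 r" for m
    unfolding \<phi>_def using holo by (auto intro!: holomorphic_intros)
  have in2: "u + v \<in> ball 0 (2 * r)" "u - v \<in> ball 0 (2 * r)" if "u \<in> ball 0 r" "v \<in> ball 0 r" for u v :: complex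
    using that norm_triangle_ineq[of u v] norm_triangle_ineq4[of u v] by auto
  \<comment> \<open>A finite geometric sum with exact remainder. Its factor
    \<open>s u ^ (2 * n)\<close> vanishes to order 2n > k at u = 0, so n terms already give the k-th
    derivative exactly.\<close>
  have expand: "f (u + v) - f (u - v) = (\<Sum>m<n. (C * p ^ m * \<phi> m v) * \<phi> m u) +
      (f (u + v) - f (u - v)) * (p ^ n * s v ^ (2 * n)) * s u ^ (2 * n)"
    if uv: "u \<in> ball 0 r" "v \<in> ball 0 r" for u v
  proof -
    define z where "z = p * (s u)\<^sup>2 * (s v)\<^sup>2"
    define d where "d = f (u + v) - f (u - v)"
    have zm: "z ^ m = p ^ m * s u ^ (2 * m) * s v ^ (2 * m)" for m
      by (simp add: z_def power_mult_distrib power_mult)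
    have "(\<Sum>m<n. (C * p ^ m * \<phi> m v) * \<phi> m u) = (\<Sum>m<n. C * S u * S v * z ^ m)"
      by (intro sum.cong) (auto simp: zm \<phi>_def mult_ac)
    also have "\<dots> = (\<Sum>m<n. d * (1 - z) * z ^ m)"
      using add[OF uv] by (simp add: d_def z_def)
    also have "\<dots> = d * ((1 - z) * (\<Sum>m<n. z ^ m))"
      by (simp add: sum_distrib_left mult.assoc)
    also have "(1 - z) * (\<Sum>m<n. z ^ m) = 1 - z ^ n"
      by (simp add: one_diff_power_eq)
    finally show ?thesis
      by (simp add: zm algebra_simps flip: d_def)
  qed
  have holo_shift: "(\<lambda>u. f (a * u + v)) holomorphic_on ball 0 r" if "v \<in> ball 0 r" "norm a = 1" for a v
  proof (rule holomorphic_on_compose_gen[OF _ holo(1), unfolded o_def])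
    show "(\<lambda>u. a * u + v) ` ball 0 r \<subseteq> ball 0 (2 * r)"
      using in2(1)[of "a * u" v for u] that by (auto simp: norm_mult)
  qed (auto intro!: holomorphic_intros)
  \<comment> \<open>The k derivatives in u are taken at u = 0 with v fixed. The second term keeps
    its minus sign for every k, since u enters f(u - v) with coefficient 1.\<close>
  have k_deriv: "(deriv ^^ k) f v - (deriv ^^ k) f (- v) = (\<Sum>m<n. (C * p ^ m * (deriv ^^ k) (\<phi> m) 0) * \<phi> m v)"
    if v: "v \<in> ball 0 r" for v
  proof -
    have v': "- v \<in> ball 0 r"
      using v by simp
    define g where "g = (\<lambda>u. (f (1 * u + v) - f (1 * u + - v)) * (p ^ n * s v ^ (2 * n)))"
    have g: "g holomorphic_on ball 0 r"
      unfolding g_def by (intro holomorphic_intros holo_shift v v') auto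
    have d: "(\<lambda>u. f (u + v) - f (u - v)) holomorphic_on ball 0 r"
      using holo_shift[OF v, of 1] holo_shift[OF v', of 1] by (auto intro!: holomorphic_intros)
    have "(deriv ^^ k) (\<lambda>u. f (1 * u + v) - f (1 * u + - v)) 0 =
        (deriv ^^ k) (\<lambda>u. f (1 * u + v)) 0 - (deriv ^^ k) (\<lambda>u. f (1 * u + - v)) 0"
      by (intro higher_deriv_diff[where S = "ball 0 r"] holo_shift v v') (use r in auto)
    also have "(deriv ^^ k) (\<lambda>u. f (1 * u + v)) 0 = 1 ^ k * (deriv ^^ k) f (1 * 0 + v)"
      by (rule higher_deriv_compose_linear'[OF holo(1), of "ball 0 r"]) (use in2(1)[OF _ v] r in auto)
    also have "(deriv ^^ k) (\<lambda>u. f (1 * u + - v)) 0 = 1 ^ k * (deriv ^^ k) f (1 * 0 + - v)"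
      by (rule higher_deriv_compose_linear'[OF holo(1), of "ball 0 r"]) (use in2(1)[OF _ v'] r in auto)
    finally have "(deriv ^^ k) f v - (deriv ^^ k) f (- v) = (deriv ^^ k) (\<lambda>u. f (1 * u + v) - f (1 * u + - v)) 0"
      by simp
    also have "\<dots> = (deriv ^^ k) (\<lambda>u. (\<Sum>m<n. (C * p ^ m * \<phi> m v) * \<phi> m u) + g u * s u ^ (2 * n)) 0"
      by (rule higher_deriv_transform_within_open[of _ "ball 0 r"])
        (use r d holo \<phi> g expand[OF _ v] in \<open>auto intro!: holomorphic_intros simp: g_def\<close>)
    also have "\<dots> = (deriv ^^ k) (\<lambda>u. \<Sum>m<n. (C * p ^ m * \<phi> m v) * \<phi> m u) 0 + (deriv ^^ k) (\<lambda>u. g u * s u ^ (2 * n)) 0"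
      by (rule higher_deriv_add[of _ "ball 0 r"]) (use r holo \<phi> g in \<open>auto intro!: holomorphic_intros\<close>)
    also have "(deriv ^^ k) (\<lambda>u. g u * s u ^ (2 * n)) 0 = 0"
      by (rule higher_deriv_mult_power_zero(1)[of "ball 0 r"]) (use r holo g s kl in auto)
    also have "(deriv ^^ k) (\<lambda>u. \<Sum>m<n. (C * p ^ m * \<phi> m v) * \<phi> m u) 0 =
        (\<Sum>m<n. (deriv ^^ k) (\<lambda>u. (C * p ^ m * \<phi> m v) * \<phi> m u) 0)"
      by (rule higher_deriv_sum[of "ball 0 r"]) (use r \<phi> in \<open>auto intro!: holomorphic_intros\<close>)
    also have "\<dots> = (\<Sum>m<n. (C * p ^ m * \<phi> m v) * (deriv ^^ k) (\<phi> m) 0)"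
      by (intro sum.cong refl higher_deriv_cmult[of _ "ball 0 r"]) (use r \<phi> in auto)
    finally show ?thesis
      by (simp add: mult_ac)
  qed
  have hf: "(deriv ^^ k) f holomorphic_on ball 0 (2 * r)"
    using holo(1) by (rule holomorphic_higher_deriv) auto
  have sub: "ball 0 r \<subseteq> ball 0 (2 * r)"
    using r by auto
  have hm: "(\<lambda>v. (deriv ^^ k) f (- 1 * v)) holomorphic_on ball 0 r"
    by (rule holomorphic_on_compose_gen[OF _ hf, unfolded o_def]) (use sub in \<open>auto intro!: holomorphic_intros\<close>)
  have "(deriv ^^ l) (\<lambda>v. (deriv ^^ k) f v - (deriv ^^ k) f (- 1 * v)) 0 =
      (deriv ^^ l) ((deriv ^^ k) f) 0 - (deriv ^^ l) (\<lambda>v. (deriv ^^ k) f (- 1 * v)) 0"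
    by (rule higher_deriv_diff[of _ "ball 0 r"]) (use hf hm r sub in \<open>auto intro: holomorphic_on_subset\<close>)
  also have "(deriv ^^ l) (\<lambda>v. (deriv ^^ k) f (- 1 * v)) 0 = (- 1) ^ l * (deriv ^^ l) ((deriv ^^ k) f) (- 1 * 0)"
    by (rule higher_deriv_compose_linear[OF hf, of "ball 0 r"]) (use r sub in auto)
  \<comment> \<open>For odd l the factor (-1)^l turns the difference into a sum, which gives the
    2.\<close>
  also have "(deriv ^^ l) ((deriv ^^ k) f) 0 - \<dots> = 2 * (deriv ^^ (k + l)) f 0"
    using kl by (simp add: funpow_add add.commute[of k])
  finally have "2 * (deriv ^^ (k + l)) f 0 = (deriv ^^ l) (\<lambda>v. (deriv ^^ k) f v - (deriv ^^ k) f (- 1 * v)) 0"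
    by simp
  also have "\<dots> = (deriv ^^ l) (\<lambda>v. \<Sum>m<n. (C * p ^ m * (deriv ^^ k) (\<phi> m) 0) * \<phi> m v) 0"
  proof (rule higher_deriv_transform_within_open[of _ "ball 0 r"])
    show "(\<lambda>v. (deriv ^^ k) f v - (deriv ^^ k) f (- 1 * v)) holomorphic_on ball 0 r"
      by (intro holomorphic_on_diff holomorphic_on_subset[OF hf sub] hm)
    show "(\<lambda>v. \<Sum>m<n. C * p ^ m * (deriv ^^ k) (\<phi> m) 0 * \<phi> m v) holomorphic_on ball 0 r"
      by (intro holomorphic_intros \<phi>)
  qed (use r k_deriv in auto)
  also have "\<dots> = (\<Sum>m<n. (deriv ^^ l) (\<lambda>v. (C * p ^ m * (deriv ^^ k) (\<phi> m) 0) * \<phi> m v) 0)"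
    by (rule higher_deriv_sum[of "ball 0 r"]) (use r \<phi> in \<open>auto intro!: holomorphic_intros\<close>)
  also have "\<dots> = (\<Sum>m<n. (C * p ^ m * (deriv ^^ k) (\<phi> m) 0) * (deriv ^^ l) (\<phi> m) 0)"
    by (intro sum.cong refl higher_deriv_cmult[of _ "ball 0 r"]) (use r \<phi> in auto)
  finally show ?thesis
    by (simp add: \<phi>_def)
qed

text \<open>Absorbing \<open>d\<close> into the transposed factor leaves a lower times an upper
  triangular matrix, with determinants read off the diagonals.\<close>

lemma det_LDL:
  fixes L :: "nat \<Rightarrow> nat \<Rightarrow> complex"
  assumes "\<And>i m. i < m \<Longrightarrow> m < n \<Longrightarrow> L i m = 0"
  shows "Determinant.det (Matrix.mat n n (\<lambda>(i, j). \<Sum>m<n. d m * L i m * L j m)) =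
    (\<Prod>m<n. d m * (L m m)\<^sup>2)"
proof -
  define A where "A = Matrix.mat n n (\<lambda>(i, m). L i m)"
  define B where "B = Matrix.mat n n (\<lambda>(m, j). d m * L j m)"
  have AB: "A \<in> carrier_mat n n" "B \<in> carrier_mat n n"
    by (simp_all add: A_def B_def)
  have "Matrix.mat n n (\<lambda>(i, j). \<Sum>m<n. d m * L i m * L j m) = A * B"
    by (rule eq_matI) (auto simp: A_def B_def scalar_prod_def lessThan_atLeast0 intro!: sum.cong)
  then have "Determinant.det (Matrix.mat n n (\<lambda>(i, j). \<Sum>m<n. d m * L i m * L j m)) =
      Determinant.det A * Determinant.det B"
    using det_mult[OF AB] by simp
  also have "Determinant.det A = prod_list (diag_mat A)"
    by (rule det_lower_triangular[OF _ AB(1)]) (use assms in \<open>auto simp: A_def\<close>)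
  also have "\<dots> = (\<Prod>m<n. L m m)"
    by (simp add: prod_list_diag_prod A_def lessThan_atLeast0)
  also have "Determinant.det B = prod_list (diag_mat B)"
    by (rule det_upper_triangular[OF _ AB(2)]) (use assms in \<open>auto simp: B_def upper_triangular_def\<close>)
  also have "\<dots> = (\<Prod>m<n. d m * L m m)"
    by (simp add: prod_list_diag_prod B_def lessThan_atLeast0)
  finally show ?thesis
    by (simp add: prod.distrib power2_eq_square mult_ac)
qed

section \<open>The determinant formula\<close>

lemma theta3_0_eq_Theta: "theta3_0 q = Theta q 1"
  by (simp add: theta3_0_def Theta_def)

text \<open>The triangular numbers are the values 2n^2 + n for integer n: j = 2n gives the
  nonnegative n, and j = 2n + 1 gives the index -(n + 1).\<close>

lemma Delta_eq_Theta:
  assumes q: "q \<noteq> 0" "norm q < 1"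
  shows "Delta q = Theta (q\<^sup>2) q"
proof -
  have q2: "norm (q\<^sup>2) < 1"
    using q by (simp add: norm_power power_less_one_iff)
  define f where "f j = q ^ (j * (j + 1) div 2)" for j
  define a where "a n = (q\<^sup>2) ^ (n ^ 2) * q ^ n" for n
  define b where "b n = (q\<^sup>2) ^ (n ^ 2) * (1 / q) ^ n" for n
  have fa: "f (2 * n) = a n" for n
  proof -
    have "2 * n * (2 * n + 1) div 2 = 2 * n ^ 2 + n"
      by (simp add: power2_eq_square algebra_simps)
    then show ?thesis
      by (simp add: f_def a_def power_add power_mult)
  qed
  have fb: "f (2 * n + 1) = b (Suc n)" for n
  proof -
    have e: "(2 * n + 1) * (2 * n + 1 + 1) div 2 + Suc n = 2 * Suc n ^ 2"
      by (simp add: power2_eq_square algebra_simps)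
    have "f (2 * n + 1) * q ^ Suc n = (q\<^sup>2) ^ (Suc n ^ 2)"
      unfolding f_def power_add[symmetric] e by (simp add: power_mult)
    then show ?thesis
      using q by (simp add: b_def power_one_over field_simps del: power_Suc)
  qed
  have suma: "summable (\<lambda>n. norm (a n))" and sumb: "summable (\<lambda>n. norm (b n))"
    unfolding a_def b_def by (rule summable_theta_nat[OF q2])+
  have "(a has_sum suminf a) UNIV"
    by (intro norm_summable_imp_has_sum suma summable_sums[OF summable_norm_cancel])
  then have "(f has_sum suminf a) (range (\<lambda>n. 2 * n))"
    by (subst has_sum_reindex) (auto simp: inj_on_def o_def fa)
  moreover have "summable (\<lambda>n. norm (b (Suc n)))"
    using sumb by (subst summable_Suc_iff)
  then have "((\<lambda>n. b (Suc n)) has_sum (\<Sum>n. b (Suc n))) UNIV"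
    by (intro norm_summable_imp_has_sum summable_sums[OF summable_norm_cancel])
  then have "(f has_sum (\<Sum>n. b (Suc n))) (range (\<lambda>n. 2 * n + 1))"
    by (subst has_sum_reindex) (use fb in \<open>auto simp: inj_on_def o_def\<close>)
  ultimately have "(f has_sum (suminf a + (\<Sum>n. b (Suc n)))) (range (\<lambda>n. 2 * n) \<union> range (\<lambda>n. 2 * n + 1))"
    by (rule has_sum_Un_disjoint) (auto, presburger)
  moreover have "range (\<lambda>n. 2 * n) \<union> range (\<lambda>n. 2 * n + 1) = (UNIV :: nat set)"
  proof -
    have "m \<in> range (\<lambda>k. 2 * k) \<union> range (\<lambda>k. 2 * k + 1)" for m :: nat
      by (cases "even m") (auto elim!: evenE oddE)
    then show ?thesis by blast
  qed
  ultimately have "f sums (suminf a + (\<Sum>n. b (Suc n)))"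
    by (simp only: has_sum_imp_sums)
  moreover have "Theta (q\<^sup>2) q = suminf a + (\<Sum>n. b (Suc n))"
    unfolding a_def b_def by (rule Theta_nat[OF q2 q(1)])
  ultimately show ?thesis
    unfolding Delta_def f_def by (simp add: sums_iff)
qed

lemma norm_Lambert_coeff_le:
  fixes q :: complex
  assumes "norm q < 1"
  shows "norm (q ^ k / (1 + q ^ (2 * k + 1))) \<le> norm q ^ k / (1 - norm q)"
proof -
  have "norm (q ^ (2 * k + 1)) \<le> norm q ^ 1"
    unfolding norm_power using assms by (intro power_decreasing) auto
  then have "1 - norm q \<le> norm (1 + q ^ (2 * k + 1))"
    using norm_diff_ineq[of 1 "q ^ (2 * k + 1)"] by simp
  then have "norm q ^ k / norm (1 + q ^ (2 * k + 1)) \<le> norm q ^ k / (1 - norm q)"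
    using assms by (intro divide_left_mono) (auto intro!: mult_pos_pos)
  then show ?thesis
    by (simp only: norm_divide norm_power)
qed

text \<open>For \<alpha> = q the indices k and -1 - k carry the same coefficient and opposite
  exponents 2k + 1 and -(2k + 1), so the bilateral series folds.\<close>

lemma Lambert_fun_sums:
  fixes q u :: complex
  assumes q: "q \<noteq> 0" "norm q < 1" and u: "norm q < norm (exp (2 * u))" "norm (q * exp (2 * u)) < 1"
  shows "Lambert_fun q u = (\<Sum>k. q ^ k / (1 + q ^ (2 * k + 1)) *
    (exp (of_nat (2 * k + 1) * u) + exp (- of_nat (2 * k + 1) * u)))"
proof -
  define a where "a k = q ^ k / (1 + q ^ (2 * k + 1))" for k
  define x where "x = exp (2 * u)"
  have x: "x \<noteq> 0" by (simp add: x_def)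
  have sm: "summable (\<lambda>k. a k * y ^ k)" if "norm (q * y) < 1" for y
  proof (rule summable_norm_cancel, rule summable_comparison_test)
    have "norm (a k * y ^ k) \<le> 1 / (1 - norm q) * norm (q * y) ^ k" for k
      using mult_right_mono[OF norm_Lambert_coeff_le[OF q(2), of k], of "norm (y ^ k)"]
      unfolding a_def norm_mult[of _ "y ^ k"] by (simp add: norm_mult norm_power power_mult_distrib)
    then show "\<exists>N. \<forall>k\<ge>N. norm (norm (a k * y ^ k)) \<le> 1 / (1 - norm q) * norm (q * y) ^ k"
      by simp
    show "summable (\<lambda>k. 1 / (1 - norm q) * norm (q * y) ^ k)"
      using that by (intro summable_mult summable_geometric) simp
  qed
  have sm1: "summable (\<lambda>k. a k * x ^ k)" and sm2: "summable (\<lambda>k. a k * (1 / x) ^ k)"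
    using sm[of x] sm[of "1 / x"] u x by (auto simp: x_def norm_mult norm_divide)
  have "Lambert q q x = (\<Sum>k. a k * x ^ k) + (\<Sum>k. a k * (1 / x) ^ k * (1 / x))"
  proof -
    have "q ^ Suc k / (q ^ (2 * Suc k) + q) = a k" for k
    proof -
      have "q ^ (2 * Suc k) + q = q * (1 + q ^ (2 * k + 1))"
        by (simp add: algebra_simps)
      then show ?thesis
        using q by (simp add: a_def)
    qed
    then show ?thesis
      using Lambert_nat[of q q x] q u by (simp add: x_def a_def mult_ac)
  qed
  also have "\<dots> = (\<Sum>k. a k * x ^ k + a k * (1 / x) ^ k * (1 / x))"
    by (rule suminf_add[OF sm1 summable_mult2[OF sm2]])
  finally have F: "Lambert_fun q u = (\<Sum>k. exp u * (a k * x ^ k + a k * (1 / x) ^ k * (1 / x)))"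
    unfolding Lambert_fun_def x_def[symmetric]
    by (simp only: suminf_mult[OF summable_add[OF sm1 summable_mult2[OF sm2]]])
  have summand: "exp u * (a k * x ^ k + a k * (1 / x) ^ k * (1 / x)) =
      a k * (exp (of_nat (2 * k + 1) * u) + exp (- of_nat (2 * k + 1) * u))" for k
  proof -
    have xk: "x ^ k = exp (of_nat (2 * k) * u)" "(1 / x) ^ k = exp (- of_nat (2 * k) * u)" "1 / x = exp (- 2 * u)"
      by (simp_all add: x_def exp_of_nat_mult[symmetric] power_one_over exp_minus inverse_eq_divide mult_ac)
    have h1: "exp u * (x ^ k) = exp (of_nat (2 * k + 1) * u)"
      unfolding xk exp_add[symmetric] by (simp add: algebra_simps)
    have h2: "exp u * ((1 / x) ^ k * (1 / x)) = exp (- of_nat (2 * k + 1) * u)"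
      unfolding xk(2) unfolding xk(3) exp_add[symmetric] by (simp add: algebra_simps)
    have "exp u * (a k * x ^ k + a k * (1 / x) ^ k * (1 / x)) =
        a k * (exp u * x ^ k) + a k * (exp u * ((1 / x) ^ k * (1 / x)))"
      by (simp only: distrib_left mult_ac)
    then show ?thesis
      unfolding h1 h2 by (simp only: distrib_left)
  qed
  have "Lambert_fun q u = (\<Sum>k. a k * (exp (of_nat (2 * k + 1) * u) + exp (- of_nat (2 * k + 1) * u)))"
    unfolding F by (simp only: summand)
  then show ?thesis
    by (simp only: a_def)
qed

lemma higher_deriv_exp_linear:
  fixes c :: complex
  shows "(deriv ^^ m) (\<lambda>u. exp (c * u)) = (\<lambda>u. c ^ m * exp (c * u))"
proof (induction m)
  case (Suc m)
  have "deriv (\<lambda>u. c ^ m * exp (c * u)) = (\<lambda>u. c ^ Suc m * exp (c * u))"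
    by (intro ext DERIV_imp_deriv) (auto intro!: derivative_eq_intros)
  then show ?case
    by (simp add: Suc)
qed simp

lemma summable_odd_power_geometric:
  fixes r :: real
  assumes "0 \<le> r" "r < 1"
  shows "summable (\<lambda>k. real (2 * k + 1) ^ m * r ^ k)"
proof -
  have "(\<lambda>k. real (2 * k + 3) / real (2 * k + 1)) \<longlonglongrightarrow> 1"
    by real_asymp
  then have "(\<lambda>k. (real (2 * k + 3) / real (2 * k + 1)) ^ m * r) \<longlonglongrightarrow> 1 ^ m * r"
    by (intro tendsto_intros)
  then have "eventually (\<lambda>k. (real (2 * k + 3) / real (2 * k + 1)) ^ m * r < (1 + r) / 2) sequentially"
    by (rule order_tendstoD) (use assms in auto)
  then obtain N where N: "\<And>k. k \<ge> N \<Longrightarrow> (real (2 * k + 3) / real (2 * k + 1)) ^ m * r < (1 + r) / 2"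
    by (auto simp: eventually_sequentially)
  show ?thesis
  proof (rule summable_ratio_test[of "(1 + r) / 2" N])
    fix k assume "k \<ge> N"
    have "real (2 * Suc k + 1) ^ m * r ^ Suc k =
        (real (2 * k + 3) / real (2 * k + 1)) ^ m * r * (real (2 * k + 1) ^ m * r ^ k)"
      by (simp add: power_divide numeral_3_eq_3)
    also have "\<dots> \<le> (1 + r) / 2 * (real (2 * k + 1) ^ m * r ^ k)"
      using N[OF \<open>k \<ge> N\<close>] assms by (intro mult_right_mono) auto
    finally show "norm (real (2 * Suc k + 1) ^ m * r ^ Suc k) \<le> (1 + r) / 2 * norm (real (2 * k + 1) ^ m * r ^ k)"
      using assms by simp
  qed (use assms in auto)
qed

lemma Ttilde_sums:
  assumes q: "norm q < 1"
  shows "(\<lambda>k. of_nat (2 * k + 1) ^ m * (q ^ k / (1 + q ^ (2 * k + 1)))) sums Ttilde m q"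
proof -
  define g where "g k = of_nat (2 * k + 1) ^ m * (q ^ k / (1 + q ^ (2 * k + 1)))" for k
  have le: "norm (g k) \<le> 1 / (1 - norm q) * (real (2 * k + 1) ^ m * norm q ^ k)" for k
    using mult_left_mono[OF norm_Lambert_coeff_le[OF q, of k], of "real (2 * k + 1) ^ m"]
    unfolding g_def norm_mult norm_power norm_of_nat by simp
  have "summable (\<lambda>k. 1 / (1 - norm q) * (real (2 * k + 1) ^ m * norm q ^ k))"
    by (intro summable_mult summable_odd_power_geometric) (use q in auto)
  then have "summable (\<lambda>k. norm (g k))"
    by (rule summable_comparison_test'[of _ 0]) (simp only: real_norm_def abs_norm_cancel le)
  then have "(g has_sum suminf g) UNIV"
    by (intro norm_summable_imp_has_sum summable_sums[OF summable_norm_cancel])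
  also have "?this \<longleftrightarrow> ((\<lambda>r. of_nat (2 * r - 1) ^ m * q ^ (r - 1) / (1 + q ^ (2 * r - 1))) has_sum suminf g) {1..}"
    by (rule has_sum_reindex_bij_witness[where i = "\<lambda>r. r - 1" and j = Suc]) (auto simp: g_def)
  finally have "Ttilde m q = suminf g"
    unfolding Ttilde_def by (rule infsumI)
  then show ?thesis
    using \<open>(g has_sum suminf g) UNIV\<close> has_sum_imp_sums by (auto simp: g_def[abs_def])
qed

lemma Lambert_region:
  fixes q :: complex
  assumes q: "q \<noteq> 0" "norm q < 1"
  obtains \<epsilon> where "\<epsilon> > 0" "norm q * exp (2 * \<epsilon>) < 1"
    "\<And>u :: complex. u \<in> ball 0 \<epsilon> \<Longrightarrow> norm q < norm (exp (2 * u))"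
    "\<And>u :: complex. u \<in> ball 0 \<epsilon> \<Longrightarrow> norm (q * exp (2 * u)) < 1"
proof -
  \<comment> \<open>Then exp(2 \<epsilon>) = |q|^(-1/2), so |exp(2u)| stays between |q|^(1/2) and
    |q|^(-1/2), well inside the annulus.\<close>
  define \<epsilon> where "\<epsilon> = - ln (norm q) / 4"
  have e: "\<epsilon> > 0"
    using q by (simp add: \<epsilon>_def)
  have nq: "norm q = exp (- 4 * \<epsilon>)"
    using q by (simp add: \<epsilon>_def)
  have 1: "norm q * exp (2 * \<epsilon>) < 1"
    using e by (simp add: nq flip: exp_add)
  have "norm q < norm (exp (2 * u)) \<and> norm (q * exp (2 * u)) < 1" if "u \<in> ball 0 \<epsilon>" for u :: complex
  proof -
    have "\<bar>Re u\<bar> < \<epsilon>"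
      using that abs_Re_le_cmod[of u] by simp
    then show ?thesis
      using e by (simp add: nq norm_mult flip: exp_add) linarith
  qed
  then show ?thesis
    using that[OF e 1] by blast
qed

text \<open>The majorant gives uniform convergence near 0, which allows termwise differentiation. At
  even order exp(c u) and exp(-c u) contribute equally, hence the 2.\<close>

lemma higher_deriv_Lambert_fun:
  assumes q: "q \<noteq> 0" "norm q < 1"
  shows "(deriv ^^ (2 * m)) (Lambert_fun q) 0 = 2 * Ttilde (2 * m) q"
proof -
  obtain \<epsilon> where \<epsilon>: "\<epsilon> > 0" "norm q * exp (2 * \<epsilon>) < 1"
    "\<And>u :: complex. u \<in> ball 0 \<epsilon> \<Longrightarrow> norm q < norm (exp (2 * u))"
    "\<And>u :: complex. u \<in> ball 0 \<epsilon> \<Longrightarrow> norm (q * exp (2 * u)) < 1"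
    by (rule Lambert_region[OF q]) (rule that; blast)
  define a where "a k = q ^ k / (1 + q ^ (2 * k + 1))" for k
  define c where "c k = (of_nat (2 * k + 1) :: complex)" for k
  define t where "t k u = a k * (exp (c k * u) + exp (- c k * u))" for k u
  have "norm (t k u) \<le> 2 * exp \<epsilon> / (1 - norm q) * (norm q * exp (2 * \<epsilon>)) ^ k"
    if "u \<in> ball 0 \<epsilon>" for k u
  proof -
    have re: "\<bar>Re u\<bar> \<le> \<epsilon>"
      using that abs_Re_le_cmod[of u] by simp
    have abs: "\<bar>real (2 * k + 1) * Re u\<bar> \<le> real (2 * k + 1) * \<epsilon>"
      unfolding abs_mult using re by (intro mult_mono) auto
    have Re: "Re (c k * u) = real (2 * k + 1) * Re u" "Re (- c k * u) = - (real (2 * k + 1) * Re u)"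
      by (simp_all add: c_def algebra_simps)
    have "norm (exp (c k * u)) \<le> exp (real (2 * k + 1) * \<epsilon>)"
      "norm (exp (- c k * u)) \<le> exp (real (2 * k + 1) * \<epsilon>)"
      unfolding norm_exp_eq_Re Re exp_le_cancel_iff using abs unfolding abs_le_iff by blast+
    then have "norm (exp (c k * u) + exp (- c k * u)) \<le> 2 * exp (real (2 * k + 1) * \<epsilon>)"
      using norm_triangle_ineq[of "exp (c k * u)" "exp (- c k * u)"] by linarith
    also have "exp (real (2 * k + 1) * \<epsilon>) = exp \<epsilon> * exp (2 * \<epsilon>) ^ k"
      by (simp add: exp_of_nat_mult[symmetric] algebra_simps flip: exp_add)
    finally have "norm (t k u) \<le> norm q ^ k / (1 - norm q) * (2 * (exp \<epsilon> * exp (2 * \<epsilon>) ^ k))"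
      unfolding t_def norm_mult a_def using norm_Lambert_coeff_le[OF q(2), of k] q by (intro mult_mono) auto
    then show ?thesis
      by (simp add: power_mult_distrib mult_ac)
  qed
  moreover have "summable (\<lambda>k. 2 * exp \<epsilon> / (1 - norm q) * (norm q * exp (2 * \<epsilon>)) ^ k)"
    using \<epsilon> by (intro summable_mult summable_geometric) simp
  ultimately have "uniform_limit (ball 0 \<epsilon>) (\<lambda>N u. \<Sum>k<N. t k u) (\<lambda>u. \<Sum>k. t k u) sequentially"
    by (rule Weierstrass_m_test)
  also have "?this \<longleftrightarrow> uniform_limit (ball 0 \<epsilon>) (\<lambda>N u. \<Sum>k<N. t k u) (Lambert_fun q) sequentially"
    by (intro uniform_limit_cong') (auto simp: Lambert_fun_sums[OF q \<epsilon>(3,4)] t_def a_def c_def)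
  finally have "(\<lambda>N. (deriv ^^ (2 * m)) (\<lambda>u. \<Sum>k<N. t k u) 0) \<longlonglongrightarrow> (deriv ^^ (2 * m)) (Lambert_fun q) 0"
    by (rule higher_deriv_complex_uniform_limit)
      (use \<epsilon>(1) in \<open>auto intro!: always_eventually holomorphic_intros simp: t_def\<close>)
  moreover have "(deriv ^^ (2 * m)) (\<lambda>u. \<Sum>k<N. t k u) 0 = (\<Sum>k<N. 2 * (c k ^ (2 * m) * a k))" for N
  proof -
    have "(deriv ^^ (2 * m)) (t k) 0 = 2 * (c k ^ (2 * m) * a k)" for k
    proof -
      have "(deriv ^^ (2 * m)) (\<lambda>u. a k * (exp (c k * u) + exp (- c k * u))) 0 =
          a k * (deriv ^^ (2 * m)) (\<lambda>u. exp (c k * u) + exp (- c k * u)) 0"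
        by (rule higher_deriv_cmult[of _ UNIV]) (auto intro!: holomorphic_intros)
      also have "(deriv ^^ (2 * m)) (\<lambda>u. exp (c k * u) + exp (- c k * u)) 0 =
          (deriv ^^ (2 * m)) (\<lambda>u. exp (c k * u)) 0 + (deriv ^^ (2 * m)) (\<lambda>u. exp (- c k * u)) 0"
        by (rule higher_deriv_add[of _ UNIV]) (auto intro!: holomorphic_intros)
      finally show ?thesis
        unfolding t_def[abs_def] higher_deriv_exp_linear by simp
    qed
    then show ?thesis
      by (subst higher_deriv_sum[of UNIV]) (auto intro!: holomorphic_intros simp: t_def[abs_def])
  qed
  moreover have "(\<lambda>N. \<Sum>k<N. 2 * (c k ^ (2 * m) * a k)) \<longlonglongrightarrow> 2 * Ttilde (2 * m) q"
    using sums_mult[OF Ttilde_sums[OF q(2), of "2 * m"], of 2] by (simp add: sums_def a_def c_def)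
  ultimately show ?thesis
    using LIMSEQ_unique by simp
qed

section \<open>Assembling the determinant\<close>

lemma deriv_mult_of_zero:
  fixes f g :: "complex \<Rightarrow> complex"
  assumes "open A" "z \<in> A" "f holomorphic_on A" "g holomorphic_on A" "f z = 0"
  shows "deriv (\<lambda>u. f u * g u) z = deriv f z * g z"
proof (rule DERIV_imp_deriv)
  show "((\<lambda>u. f u * g u) has_field_derivative deriv f z * g z) (at z)"
    using DERIV_mult[OF holomorphic_derivI[OF assms(3,1,2)] holomorphic_derivI[OF assms(4,1,2)]] assms(5)
    by simp
qed

text \<open>Over m < n the sums of m and of 2m + 1 are n(n-1)/2 and n^2; so the powers of 16 collect
  to 4^(n(n-1)) and the exponent of y to 4 n^2 = (2n)^2.\<close>

lemma prod_closed_form: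
  fixes x y q :: complex
  shows "(\<Prod>m<n. 16 ^ m * q ^ m * (fact (2 * m + 1))\<^sup>2 * x\<^sup>2 * y ^ (4 * (2 * m + 1))) =
    4 ^ (n * (n - 1)) * q ^ (n * (n - 1) div 2) * (\<Prod>r = 1..n. (fact (2 * r - 1))\<^sup>2) *
      (x ^ (2 * n) * y ^ ((2 * n) ^ 2))"
proof (induction n)
  case (Suc n)
  have e1: "Suc n * (Suc n - 1) = n * (n - 1) + 2 * n"
    by (cases n) (simp_all add: algebra_simps)
  have e2: "Suc n * (Suc n - 1) div 2 = n * (n - 1) div 2 + n"
    unfolding e1 by simp
  have e3: "(2 * Suc n)\<^sup>2 = (2 * n)\<^sup>2 + 4 * (2 * n + 1)"
    by (simp add: power2_eq_square algebra_simps)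
  have e4: "(4 :: complex) ^ (2 * n) = 16 ^ n"
    by (simp add: power_mult)
  have e5: "2 * Suc n - 1 = 2 * n + 1" "2 * Suc n = 2 * n + 2"
    by simp_all
  have e6: "(\<Prod>r = 1..Suc n. (fact (2 * r - 1) :: complex)\<^sup>2) =
      (\<Prod>r = 1..n. (fact (2 * r - 1))\<^sup>2) * (fact (2 * n + 1))\<^sup>2"
    by (simp add: prod.atLeast_Suc_atMost_Suc_shift del: fact_Suc)
  show ?case
    unfolding prod.lessThan_Suc Suc.IH e2 e3 e6 unfolding e1 e5(2) power_add e4
    by (simp only: mult_ac)
qed simp

theorem corollary5p15:
  fixes q :: complex and n :: nat
  assumes "0 < norm q" and "norm q < 1" and "n \<ge> 1"
  shows "theta3_0 q ^ (2 * n) * Delta q ^ ((2 * n) ^ 2) =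
    (4 powi (- int (n * (n - 1))) * q powi (- int (n * (n - 1) div 2)) *
      (\<Prod>r = 1..n. (fact (2 * r - 1) :: complex) powi (- 2))) *
    Determinant.det (Ttilde_matrix n q)"
proof -
  have q: "q \<noteq> 0" "norm q < 1"
    using assms by auto
  define a b c where "a = Theta q q" and "b = Theta q 1" and "c = Theta q (- 1)"
  have c0: "c \<noteq> 0"
    using q by (simp add: c_def Theta_minus_1_nonzero)
  obtain \<epsilon> where \<epsilon>: "\<epsilon> > 0" "norm q * exp (2 * \<epsilon>) < 1"
    "\<And>u :: complex. u \<in> ball 0 \<epsilon> \<Longrightarrow> norm q < norm (exp (2 * u))"
    "\<And>u :: complex. u \<in> ball 0 \<epsilon> \<Longrightarrow> norm (q * exp (2 * u)) < 1"
    by (rule Lambert_region[OF q]) (rule that; blast)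
  have "continuous_on UNIV (theta4 q)"
    by (intro holomorphic_on_imp_continuous_on theta_holomorphic q)
  then have "open (theta4 q -` (- {0}))"
    by (rule open_vimage[rotated]) auto
  moreover have "0 \<in> theta4 q -` (- {0})"
    using c0 by (simp add: theta_0 c_def)
  ultimately obtain \<delta> where "\<delta> > 0" "ball 0 \<delta> \<subseteq> theta4 q -` (- {0})"
    by (meson openE)
  then have \<delta>: "\<delta> > 0" "\<And>u. u \<in> ball 0 \<delta> \<Longrightarrow> theta4 q u \<noteq> 0"
    by auto
  \<comment> \<open>Halved so that u + v and u - v stay where the Lambert series converges and
    \<open>theta4\<close> has no zero.\<close>
  define r where "r = min \<epsilon> \<delta> / 2"
  have r: "r > 0" "2 * r \<le> \<epsilon>" "2 * r \<le> \<delta>"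
    using \<epsilon> \<delta> by (auto simp: r_def)
  have nz: "theta4 q u \<noteq> 0" if "u \<in> ball 0 (2 * r)" for u
    using \<delta>(2)[of u] that r by auto
  have reg: "norm q < norm (exp (2 * u))" "norm (q * exp (2 * u)) < 1" if "u \<in> ball 0 (2 * r)" for u
    using \<epsilon>(3,4)[of u] that r by auto
  have nz': "theta4 q u \<noteq> 0" if "u \<in> ball 0 r" for u
    using nz[of u] that r by auto
  \<comment> \<open>Up to constants \<open>S\<close> is sn dn and \<open>s\<close> is sn. Both are
    written as \<open>theta1\<close> times a factor, so their derivatives at 0 follow from Jacobi's
    formula.\<close>
  define S where "S u = theta1 q u * (theta3 q u / (theta4 q u)\<^sup>2)" for u
  define s where "s u = theta1 q u * (1 / theta4 q u)" for u
  have hol: "S holomorphic_on ball 0 r" "s holomorphic_on ball 0 r"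
    "(\<lambda>u. theta3 q u / (theta4 q u)\<^sup>2) holomorphic_on ball 0 r" "(\<lambda>u. 1 / theta4 q u) holomorphic_on ball 0 r"
    unfolding S_def s_def using nz' by (auto intro!: holomorphic_intros theta_holomorphic q)
  have Ss0: "S 0 = 0" "s 0 = 0"
    using q by (simp_all add: S_def s_def theta_0)
  have dS: "deriv S 0 = a * b * c * (b / c\<^sup>2)" and ds: "deriv s 0 = a * b * c * (1 / c)"
    unfolding S_def s_def using r q hol(3,4)
    by (subst deriv_mult_of_zero[of "ball 0 r"];
        simp add: theta_holomorphic theta_0 jacobi_derivative_formula a_def b_def c_def)+
  have "(\<lambda>u. a * c / 2 * theta2 q u / theta4 q u) holomorphic_on ball 0 (2 * r)"
    using nz by (auto intro!: holomorphic_intros theta_holomorphic q)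
  moreover have "a * c / 2 * theta2 q u / theta4 q u = Lambert_fun q u" if "u \<in> ball 0 (2 * r)" for u
    using Lambert_self_eq_Theta_quotient[OF q reg[OF that]] nz[OF that]
    by (simp add: Lambert_fun_def theta4_def theta2_def a_def c_def field_simps)
  ultimately have f: "Lambert_fun q holomorphic_on ball 0 (2 * r)"
    by (rule holomorphic_transform)
  have add: "(Lambert_fun q (u + v) - Lambert_fun q (u - v)) * (1 - q * (s u)\<^sup>2 * (s v)\<^sup>2) = c\<^sup>2 * S u * S v"
    if uv: "u \<in> ball 0 r" "v \<in> ball 0 r" for u v
  proof -
    have "u + v \<in> ball 0 (2 * r)" "u - v \<in> ball 0 (2 * r)"
      using uv norm_triangle_ineq[of u v] norm_triangle_ineq4[of u v] by auto
    from Lambert_fun_addition[OF q reg[OF this(1)] reg[OF this(2)]] show ?thesis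
      using nz'[OF uv(1)] nz'[OF uv(2)]
      by (simp add: S_def s_def c_def power_mult_distrib power_divide field_simps)
  qed
  define L where "L i m = (deriv ^^ (2 * i + 1)) (\<lambda>u. S u * s u ^ (2 * m)) 0" for i m
  \<comment> \<open>The orders 2i + 1 and 2j + 1 add up to 2(r + s - 1) with r = i + 1, s = j + 1.
    The 4 is a 2 from the Hankel decomposition times a 2 from the derivatives of
    \<open>Lambert_fun\<close>.\<close>
  have entry: "Ttilde (2 * ((i + 1) + (j + 1) - 1)) q = (\<Sum>m<n. c\<^sup>2 * q ^ m / 4 * L i m * L j m)"
    if "i < n" for i j
  proof -
    have "2 * (deriv ^^ (2 * i + 1 + (2 * j + 1))) (Lambert_fun q) 0 = (\<Sum>m<n. c\<^sup>2 * q ^ m * L i m * L j m)"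
      unfolding L_def by (rule hankel_decomposition[OF r(1) f hol(1,2) Ss0(2) add]) (use that in auto)
    moreover have "2 * i + 1 + (2 * j + 1) = 2 * ((i + 1) + (j + 1) - 1)"
      by simp
    ultimately have "2 * (2 * Ttilde (2 * ((i + 1) + (j + 1) - 1)) q) = (\<Sum>m<n. c\<^sup>2 * q ^ m * L i m * L j m)"
      using higher_deriv_Lambert_fun[OF q, of "(i + 1) + (j + 1) - 1"] by (simp only:)
    then show ?thesis
      by (simp add: sum_divide_distrib[symmetric] mult.commute[of _ 4])
  qed
  have L_upper: "L i m = 0" if "i < m" for i m
    unfolding L_def using r hol Ss0 that
    by (intro higher_deriv_mult_power_zero(2)[of "ball 0 r"]) auto
  have L_diag: "L m m = fact (2 * m + 1) * deriv S 0 * deriv s 0 ^ (2 * m)" for m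
    unfolding L_def using higher_deriv_mult_power_zero(3)[of "ball 0 r" S s "2 * m"] r hol Ss0 by simp
  have "Ttilde_matrix n q = Matrix.mat n n (\<lambda>(i, j). \<Sum>m<n. c\<^sup>2 * q ^ m / 4 * L i m * L j m)"
    unfolding Ttilde_matrix_def by (rule cong_mat) (simp_all only: prod.case entry)
  then have det_L: "Determinant.det (Ttilde_matrix n q) = (\<Prod>m<n. c\<^sup>2 * q ^ m / 4 * (L m m)\<^sup>2)"
    using det_LDL[of n L "\<lambda>m. c\<^sup>2 * q ^ m / 4"] L_upper by simp
  have factor: "c\<^sup>2 * q ^ m / 4 * (L m m)\<^sup>2 =
      16 ^ m * q ^ m * (fact (2 * m + 1))\<^sup>2 * b\<^sup>2 * Delta q ^ (4 * (2 * m + 1))" for m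
  proof -
    define D where "D = Delta q"
    \<comment> \<open>Here the null values \<open>a\<close> and \<open>c\<close> disappear:
      \<open>c\<close> cancels from \<open>deriv s 0\<close> and \<open>c * deriv S 0\<close>, and
      \<open>a\<close> occurs only in this product. The 4 from squaring 2 D^2 b cancels the 1/4, and
      (2 D^2)^(4m) supplies 16^m.\<close>
    have ab: "a * b = 2 * D\<^sup>2"
      using Theta_1_mult_Theta_self[of q] q by (simp add: D_def Delta_eq_Theta a_def b_def mult.commute)
    have ds': "deriv s 0 = 2 * D\<^sup>2"
      using c0 by (simp add: ds ab)
    have dS': "c * deriv S 0 = 2 * D\<^sup>2 * b"
      using c0 ab by (simp add: dS power2_eq_square)
    have "c\<^sup>2 * q ^ m / 4 * (L m m)\<^sup>2 =
        q ^ m / 4 * (fact (2 * m + 1))\<^sup>2 * (c * deriv S 0)\<^sup>2 * (deriv s 0 ^ (2 * m))\<^sup>2"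
      by (simp add: L_diag power_mult_distrib mult_ac del: fact_Suc)
    also have "\<dots> = q ^ m * (fact (2 * m + 1))\<^sup>2 * b\<^sup>2 * (D ^ 4 * (2 * D\<^sup>2) ^ (4 * m))"
      unfolding dS' ds' by (simp add: power_mult_distrib power_mult[symmetric] mult_ac del: fact_Suc)
    also have "(2 * D\<^sup>2) ^ (4 * m) = 16 ^ m * D ^ (8 * m)"
      by (simp add: power_mult_distrib power_mult[symmetric]) (simp add: power_mult)
    also have "D ^ 4 * (16 ^ m * D ^ (8 * m)) = 16 ^ m * D ^ (4 * (2 * m + 1))"
      by (simp add: power_add[symmetric] algebra_simps)
    finally show ?thesis
      by (simp add: D_def mult_ac del: fact_Suc)
  qed
  have det: "Determinant.det (Ttilde_matrix n q) =
      4 ^ (n * (n - 1)) * q ^ (n * (n - 1) div 2) * (\<Prod>r = 1..n. (fact (2 * r - 1))\<^sup>2) *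
      (b ^ (2 * n) * Delta q ^ ((2 * n) ^ 2))"
    unfolding det_L factor by (rule prod_closed_form)
  have "(\<Prod>r = 1..n. (fact (2 * r - 1) :: complex) powi (- 2)) = inverse (\<Prod>r = 1..n. (fact (2 * r - 1))\<^sup>2)"
    by (simp add: power_int_minus prod_inversef[symmetric])
  moreover have "(\<Prod>r = 1..n. (fact (2 * r - 1) :: complex)\<^sup>2) \<noteq> 0"
    by simp
  ultimately show ?thesis
    unfolding det theta3_0_eq_Theta b_def[symmetric] power_int_minus power_int_of_nat
    using q by (simp add: field_simps)
qed

end
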